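(* Let $\Bbbk$ be a field of characteristic zero. Among the Poisson fields $K_{\mathrm{Weyl}}=K\{1\}$, $K_q=K\{qxy\}$ ($q\in\Bbbk^\times$), and $K_{1,n,0}=K\{x^{n+1}y\}$ ($n\ge2$), there are the following embeddings: (1) $K_{\mathrm{Weyl}}$ embeds in $K_{1,n,0}$ for any $n\ge2$. (2) For $p,q\in\Bbbk^\times$, $K_p$ embeds in $K_q$ if and only if $p\in\mathbb Z q$. (3) For $m,n\ge2$, $K_{1,m,0}$ embeds in $K_{1,n,0}$ if and only if $m\mid n$. There are no other embeddings: (4) $K_{\mathrm{Weyl}}$ and $K_{1,n,0}$ for $n\ge2$ do not embed in any $K_q$ ($q\in\Bbbk^\times$). (5) $K_{1,n,0}$ for $n\ge2$ does not embed in $K_{\mathrm{Weyl}}$. (6) No $K_q$ ($q\in\Bbbk^\times$) embeds in $K_{\mathrm{Weyl}}$ or in $K_{1,n,0}$ for $n\ge2$.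
   Context: For $\mathbf f\in\Bbbk(x,y)$, $K\{\mathbf f\}$ denotes the rational function field $\Bbbk(x,y)$ equipped with the unique ($\Bbbk$-bilinear) Poisson bracket such that $\{x,y\}=\mathbf f$; explicitly $\{g,h\}=\left(\frac{\partial g}{\partial x}\frac{\partial h}{\partial y}-\frac{\partial g}{\partial y}\frac{\partial h}{\partial x}\right)\mathbf f$. An embedding $K\to L$ of Poisson fields is a (necessarily injective) $\Bbbk$-algebra homomorphism preserving the Poisson brackets; "$K$ embeds in $L$" means such a map exists. *)

theory Defs
  imports "HOL-Computational_Algebra.Computational_Algebra"
begin

(* The rational function field k(x,y) is the fraction field of k[x][y]: the inner polynomial
   variable is x and the outer one is y. *)

type_synonym 'a ratfun2 = "'a poly poly fract"

definition rf_const :: "'a::field_char_0 \<Rightarrow> 'a ratfun2" where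
  "rf_const c = to_fract [:[:c:]:]"

definition rf_x :: "'a::field_char_0 ratfun2" where
  "rf_x = to_fract [:[:0, 1:]:]"

definition rf_y :: "'a::field_char_0 ratfun2" where
  "rf_y = to_fract [:0, 1:]"

definition poly_dx :: "'a::field_char_0 poly poly \<Rightarrow> 'a poly poly" where
  "poly_dx = map_poly pderiv"

lemma coeff_poly_dx: "coeff (poly_dx p) n = pderiv (coeff p n)"
  by (simp add: poly_dx_def coeff_map_poly)

lemma poly_dx_add: "poly_dx (p + q) = poly_dx p + poly_dx q"
  by (rule poly_eqI) (simp add: coeff_poly_dx pderiv_add)

lemma pderiv_sum: "pderiv (sum f A) = (\<Sum>i\<in>A. pderiv (f i :: 'a::field_char_0 poly))"
  by (induction A rule: infinite_finite_induct) (simp_all add: pderiv_add)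

lemma poly_dx_mult: "poly_dx (p * q) = poly_dx p * q + p * poly_dx q"
proof (rule poly_eqI)
  have "pderiv (r * s) = pderiv r * s + r * pderiv s" for r s :: "'a poly"
    by (simp add: pderiv_mult)
  then show "coeff (poly_dx (p * q)) n = coeff (poly_dx p * q + p * poly_dx q) n" for n
    by (simp add: coeff_poly_dx coeff_mult pderiv_sum sum.distrib)
qed

lemma pderiv_poly_dx: "pderiv (poly_dx p) = poly_dx (pderiv p)"
  by (rule poly_eqI) (simp add: coeff_poly_dx coeff_pderiv pderiv_mult pderiv_add)

lemma quotient_rule_respects:
  fixes D :: "'b::idom \<Rightarrow> 'b"
  assumes mult: "\<And>p q. D (p * q) = D p * q + p * D q" and eq: "a * b' = a' * b"
  shows "(D a * b - a * D b) * (b' * b') = (D a' * b' - a' * D b') * (b * b)"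
proof -
  have D: "D a * b' = D a' * b + a' * D b - a * D b'"
    using mult[of a b'] mult[of a' b] eq by (simp add: eq_diff_eq)
  have "(D a * b - a * D b) * (b' * b') = b * b' * (D a * b') - (a * b') * (D b * b')"
    by (simp add: algebra_simps)
  also have "\<dots> = b * b' * (D a * b') - (a' * b) * (D b * b')"
    unfolding eq ..
  also have "\<dots> = b * b' * D a' * b - b * (a * b') * D b'"
    unfolding D by (simp add: algebra_simps)
  also have "\<dots> = (D a' * b' - a' * D b') * (b * b)"
    unfolding eq by (simp add: algebra_simps)
  finally show ?thesis .
qed

(* Extension of a derivation to the fraction field by the quotient rule. The value does not
   depend on the representing fraction, so the description is proper for a derivation D. *)

definition fract_deriv :: "('b::idom \<Rightarrow> 'b) \<Rightarrow> 'b fract \<Rightarrow> 'b fract" where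
  "fract_deriv D g = (THE r. \<forall>a b. b \<noteq> 0 \<longrightarrow> g = Fract a b \<longrightarrow>
     r = Fract (D a * b - a * D b) (b * b))"

lemma fract_deriv_Fract:
  assumes mult: "\<And>p q. D (p * q) = D p * q + p * D q" and b: "b \<noteq> 0"
  shows "fract_deriv D (Fract a b) = Fract (D a * b - a * D b) (b * b)"
  unfolding fract_deriv_def
proof (rule the_equality)
  show "\<forall>a' b'. b' \<noteq> 0 \<longrightarrow> Fract a b = Fract a' b' \<longrightarrow>
      Fract (D a * b - a * D b) (b * b) = Fract (D a' * b' - a' * D b') (b' * b')"
    using b quotient_rule_respects[of D, OF mult] by (simp add: eq_fract)
qed (use b in blast)

definition rf_dx :: "'a::field_char_0 ratfun2 \<Rightarrow> 'a ratfun2" where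
  "rf_dx = fract_deriv poly_dx"

definition rf_dy :: "'a::field_char_0 ratfun2 \<Rightarrow> 'a ratfun2" where
  "rf_dy = fract_deriv pderiv"

lemma rf_dx_Fract: "b \<noteq> 0 \<Longrightarrow> rf_dx (Fract a b) = Fract (poly_dx a * b - a * poly_dx b) (b * b)"
  unfolding rf_dx_def by (rule fract_deriv_Fract) (rule poly_dx_mult)

lemma rf_dy_Fract: "b \<noteq> 0 \<Longrightarrow> rf_dy (Fract a b) = Fract (pderiv a * b - a * pderiv b) (b * b)"
  unfolding rf_dy_def by (rule fract_deriv_Fract) (simp_all add: pderiv_mult)

(* The Poisson field K{f} is represented by its bracket on k(x,y). *)

definition pbracket :: "'a::field_char_0 ratfun2 \<Rightarrow> 'a ratfun2 \<Rightarrow> 'a ratfun2 \<Rightarrow> 'a ratfun2" where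
  "pbracket f g h = (rf_dx g * rf_dy h - rf_dy g * rf_dx h) * f"

definition is_poisson_bracket :: "('a::field_char_0 ratfun2 \<Rightarrow> 'a ratfun2 \<Rightarrow> 'a ratfun2) \<Rightarrow> bool" where
  "is_poisson_bracket B \<longleftrightarrow>
     (\<forall>g h k. B (g + h) k = B g k + B h k) \<and>
     (\<forall>c g h. B (rf_const c * g) h = rf_const c * B g h) \<and>
     (\<forall>g. B g g = 0) \<and>
     (\<forall>g h. B g h = - B h g) \<and>
     (\<forall>g h k. B (g * h) k = g * B h k + B g k * h) \<and>
     (\<forall>g h k. B g (B h k) + B h (B k g) + B k (B g h) = 0)"

(* phi 1 = 1 is the case c = 1 of the third clause; injectivity is automatic for a unital
   homomorphism of fields. *)

definition poisson_hom ::
  "('a::field_char_0 ratfun2 \<Rightarrow> 'a ratfun2 \<Rightarrow> 'a ratfun2) \<Rightarrow>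
   ('a ratfun2 \<Rightarrow> 'a ratfun2 \<Rightarrow> 'a ratfun2) \<Rightarrow> ('a ratfun2 \<Rightarrow> 'a ratfun2) \<Rightarrow> bool" where
  "poisson_hom B B' \<phi> \<longleftrightarrow>
     (\<forall>g h. \<phi> (g + h) = \<phi> g + \<phi> h) \<and>
     (\<forall>g h. \<phi> (g * h) = \<phi> g * \<phi> h) \<and>
     (\<forall>c. \<phi> (rf_const c) = rf_const c) \<and>
     (\<forall>g h. \<phi> (B g h) = B' (\<phi> g) (\<phi> h))"

definition poisson_embeds ::
  "('a::field_char_0 ratfun2 \<Rightarrow> 'a ratfun2 \<Rightarrow> 'a ratfun2) \<Rightarrow>
   ('a ratfun2 \<Rightarrow> 'a ratfun2 \<Rightarrow> 'a ratfun2) \<Rightarrow> bool" where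
  "poisson_embeds B B' \<longleftrightarrow> (\<exists>\<phi>. poisson_hom B B' \<phi>)"

definition K_Weyl :: "'a::field_char_0 ratfun2 \<Rightarrow> 'a ratfun2 \<Rightarrow> 'a ratfun2" where
  "K_Weyl = pbracket 1"

definition K_q :: "'a::field_char_0 \<Rightarrow> 'a ratfun2 \<Rightarrow> 'a ratfun2 \<Rightarrow> 'a ratfun2" where
  "K_q q = pbracket (rf_const q * rf_x * rf_y)"

definition K_1n0 :: "nat \<Rightarrow> 'a::field_char_0 ratfun2 \<Rightarrow> 'a ratfun2 \<Rightarrow> 'a ratfun2" where
  "K_1n0 n = pbracket (rf_x ^ (n + 1) * rf_y)"

(* The bracket above is the unique Poisson bracket on k(x,y) with {x,y} = f. *)

lemma poly_dx_pCons: "poly_dx (pCons a p) = pCons (pderiv a) (poly_dx p)"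
  by (rule poly_eqI) (simp add: coeff_poly_dx coeff_pCons split: nat.split)

lemma poly_dx_0 [simp]: "poly_dx 0 = 0"
  by (simp add: poly_dx_def)

lemma poly_dx_1 [simp]: "poly_dx 1 = 0"
  by (simp only: one_pCons poly_dx_pCons poly_dx_0) (simp add: pderiv_pCons)

lemma poly_dx_diff: "poly_dx (p - q) = poly_dx p - poly_dx q"
  by (rule poly_eqI) (simp add: coeff_poly_dx pderiv_diff)

lemma rf_dx_add: "rf_dx (g + h) = rf_dx g + rf_dx h"
  by (cases g, cases h) (simp add: rf_dx_Fract eq_fract poly_dx_add poly_dx_mult algebra_simps)

lemma rf_dy_add: "rf_dy (g + h) = rf_dy g + rf_dy h"
  by (cases g, cases h) (simp add: rf_dy_Fract eq_fract pderiv_add pderiv_mult algebra_simps)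

lemma rf_dx_mult: "rf_dx (g * h) = rf_dx g * h + g * rf_dx h"
  by (cases g, cases h) (simp add: rf_dx_Fract eq_fract poly_dx_mult algebra_simps)

lemma rf_dy_mult: "rf_dy (g * h) = rf_dy g * h + g * rf_dy h"
  by (cases g, cases h) (simp add: rf_dy_Fract eq_fract pderiv_mult algebra_simps)

lemma rf_dx_dy: "rf_dx (rf_dy g) = rf_dy (rf_dx g)"
  by (cases g) (simp add: rf_dx_Fract rf_dy_Fract eq_fract poly_dx_mult pderiv_mult
      poly_dx_diff pderiv_diff pderiv_poly_dx algebra_simps)

lemma rf_dx_const [simp]: "rf_dx (rf_const c) = 0"
  and rf_dy_const [simp]: "rf_dy (rf_const c) = 0"
  and rf_dx_x [simp]: "rf_dx rf_x = 1"
  and rf_dy_x [simp]: "rf_dy rf_x = 0"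
  and rf_dx_y [simp]: "rf_dx rf_y = 0"
  and rf_dy_y [simp]: "rf_dy rf_y = 1"
  by (simp_all add: rf_const_def rf_x_def rf_y_def to_fract_def rf_dx_Fract rf_dy_Fract
      poly_dx_pCons pderiv_pCons fract_collapse flip: one_pCons)

lemma rf_dx_diff: "rf_dx (g - h) = rf_dx g - rf_dx h"
  using rf_dx_add[of "g - h" h] by simp

lemma rf_dy_diff: "rf_dy (g - h) = rf_dy g - rf_dy h"
  using rf_dy_add[of "g - h" h] by simp

lemma is_poisson_bracket_pbracket: "is_poisson_bracket (pbracket f)"
  unfolding is_poisson_bracket_def pbracket_def
  by (intro conjI allI)
     (simp_all add: rf_dx_add rf_dy_add rf_dx_mult rf_dy_mult rf_dx_diff rf_dy_diff rf_dx_dy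
       algebra_simps)

lemma pbracket_x_y: "pbracket f rf_x rf_y = f"
  by (simp add: pbracket_def)

lemma k_derivation_determined:
  fixes D :: "'a::field_char_0 ratfun2 \<Rightarrow> 'a ratfun2"
  assumes add: "\<And>g h. D (g + h) = D g + D h"
    and mult: "\<And>g h. D (g * h) = g * D h + D g * h"
    and lin: "\<And>c g. D (rf_const c * g) = rf_const c * D g"
  shows "D g = rf_dx g * D rf_x + rf_dy g * D rf_y"
proof -
  define E where "E g = D g - (rf_dx g * D rf_x + rf_dy g * D rf_y)" for g
  have E_add: "E (g + h) = E g + E h" for g h
    by (simp add: E_def add rf_dx_add rf_dy_add algebra_simps)
  have E_mult: "E (g * h) = g * E h + E g * h" for g h
    by (simp add: E_def mult rf_dx_mult rf_dy_mult algebra_simps)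
  have "D 1 = 0"
    using mult[of 1 1] by (metis add_cancel_right_left mult_1_left mult_1_right)
  then have E_const: "E (rf_const c) = 0" for c
    using lin[of c 1] by (simp add: E_def)
  have E_xy: "E rf_x = 0" "E rf_y = 0"
    by (simp_all add: E_def)
  have E_0: "E 0 = 0"
    using E_add[of 0 0] by (metis add_cancel_right_left add_0)
  have E_inner: "E (to_fract [:p:]) = 0" for p :: "'a poly"
  proof (induction p)
    case 0
    then show ?case by (simp add: E_0)
  next
    case (pCons c p)
    have "to_fract [:pCons c p:] = rf_const c + rf_x * to_fract [:p:]"
      by (simp add: rf_const_def rf_x_def flip: to_fract_add to_fract_mult)
    with pCons show ?case
      by (simp add: E_add E_mult E_const E_xy)
  qed
  have E_poly: "E (to_fract p) = 0" for p :: "'a poly poly"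
  proof (induction p)
    case 0
    then show ?case by (simp add: E_0)
  next
    case (pCons c p)
    have "to_fract (pCons c p) = to_fract [:c:] + rf_y * to_fract p"
      by (simp add: rf_y_def flip: to_fract_add to_fract_mult)
    with pCons show ?case
      by (simp add: E_add E_mult E_inner E_xy)
  qed
  have "E g = 0"
  proof (cases g)
    case (Fract a b)
    then have "g * to_fract b = to_fract a" "to_fract b \<noteq> 0"
      by (simp_all add: to_fract_def eq_fract Zero_fract_def)
    then show ?thesis
      using E_mult[of g "to_fract b"] by (simp add: E_poly)
  qed
  then show ?thesis
    by (simp add: E_def)
qed

lemma is_poisson_bracket_unique:
  assumes B: "is_poisson_bracket B" and xy: "B rf_x rf_y = f"
  shows "B = pbracket f"
proof (intro ext)
  fix g h
  have left: "B g h = rf_dx g * B rf_x h + rf_dy g * B rf_y h" for g h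
    by (rule k_derivation_determined[where D = "\<lambda>g. B g h"])
       (use B[unfolded is_poisson_bracket_def] in blast)+
  have anti: "B g h = - B h g" and diag: "B g g = 0" for g h
    using B unfolding is_poisson_bracket_def by blast+
  have yx: "B rf_y rf_x = - f"
    using anti[of rf_y rf_x] xy by simp
  have x: "B rf_x h = rf_dy h * f"
    by (simp add: anti[of rf_x h] left[of h rf_x] yx diag)
  have y: "B rf_y h = - (rf_dx h * f)"
    by (simp add: anti[of rf_y h] left[of h rf_y] xy diag)
  show "B g h = pbracket f g h"
    unfolding left[of g h] x y pbracket_def by (simp add: algebra_simps)
qed

end

(* An embedding of K{f} in K{f'} amounts to X, Y in k(x,y) with {X,Y} = f(X,Y) in K{f'}: a nonzero
   Jacobian J(X,Y) makes X and Y algebraically independent. The existing embeddings are given by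
   monomials. The others are excluded as follows.

   For a prime pi of k[x,y], the function pi J(X,Y)/(XY) has no pole along pi. At pi = x this rules
   out {X,Y} = qXY in K{x^(n+1) y}; and if {X,Y} = X^(m+1) Y for a polynomial bracket f' and m >= 2,
   it forces X to be a polynomial, a pole of order a giving ma <= 1. Since y J(X,Y)/(XY) has degree at
   most 0 in y, the equation {X,Y} = X^(m+1) Y has no solution in K{1}, and in K{k x^(n+1) y} it
   forces X to lie in k[x]; leading coefficients in y then give k b x^(n+1) X' = X^(m+1) with b an
   integer, so n = m deg X. Leading coefficients in y and then in x turn {X,Y} = pXY in K{qxy} into
   p = zq with z an integer determinant of exponents. Finally {X,Y} = 1 in K{qxy} makes
   1/(qxy) a Jacobian, that is a sum of a y-derivative and an x-derivative; taking residues in y,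
   1/(qx) would be a derivative in k(x). *)

theory Submission
  imports Defs "Berlekamp_Zassenhaus.Unique_Factorization_Poly"
begin

section \<open>Extending homomorphisms to fraction fields\<close>

text \<open>The description is proper once \<open>h\<close> is an injective ring homomorphism into a
  field: denominators stay nonzero and equal fractions get equal values.\<close>

definition fract_lift :: "('b::idom \<Rightarrow> 'c::field) \<Rightarrow> 'b fract \<Rightarrow> 'c" where
  "fract_lift h g = (THE r. \<forall>a b. b \<noteq> 0 \<longrightarrow> g = Fract a b \<longrightarrow> r = h a / h b)"

lemma derivation_divide:
  fixes E :: "'c::field \<Rightarrow> 'c"
  assumes mult: "\<And>u v. E (u * v) = E u * v + u * E v" and v: "v \<noteq> 0"
  shows "E (u / v) = (E u * v - u * E v) / (v * v)"
proof -
  have "E u = E (u / v) * v + u / v * E v"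
    using mult[of "u / v" v] v by simp
  with v show ?thesis
    by (simp add: field_simps)
qed

locale fract_embedding = inj_comm_ring_hom h for h :: "'b::idom \<Rightarrow> 'c::field"
begin

lemma fract_lift_Fract: "b \<noteq> 0 \<Longrightarrow> fract_lift h (Fract a b) = h a / h b"
  unfolding fract_lift_def
proof (rule the_equality)
  assume b: "b \<noteq> 0"
  show "\<forall>a' b'. b' \<noteq> 0 \<longrightarrow> Fract a b = Fract a' b' \<longrightarrow> h a / h b = h a' / h b'"
  proof (intro allI impI)
    fix a' b' assume b': "b' \<noteq> 0" and "Fract a b = Fract a' b'"
    then have "h (a * b') = h (a' * b)"
      using b by (simp add: eq_fract)
    then show "h a / h b = h a' / h b'"
      using b b' by (simp add: hom_mult field_simps)
  qed
qed blast

lemma fract_lift_to_fract: "fract_lift h (to_fract a) = h a"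
  by (simp add: to_fract_def fract_lift_Fract)

lemma fract_lift_add: "fract_lift h (f + g) = fract_lift h f + fract_lift h g"
  by (cases f, cases g) (simp add: fract_lift_Fract hom_add hom_mult field_simps)

lemma fract_lift_mult: "fract_lift h (f * g) = fract_lift h f * fract_lift h g"
  by (cases f, cases g) (simp add: fract_lift_Fract hom_mult)

text \<open>Both sides obey the quotient rule, so a chain rule known on the ring passes to its
  fraction field. It serves the substitution x \<mapsto> X, y \<mapsto> Y and later the Laurent
  expansion in y.\<close>

lemma fract_lift_deriv:
  assumes D1: "\<And>p q. D1 (p * q) = D1 p * q + p * D1 q"
    and D2: "\<And>p q. D2 (p * q) = D2 p * q + p * D2 q"
    and E: "\<And>u v. E (u * v) = E u * v + u * E v"
    and h: "\<And>p. E (h p) = h (D1 p) * s + h (D2 p) * t"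
  shows "E (fract_lift h g) =
    fract_lift h (fract_deriv D1 g) * s + fract_lift h (fract_deriv D2 g) * t"
proof (cases g)
  case (Fract a b)
  have D: "fract_lift h (fract_deriv D g) = (h (D a) * h b - h a * h (D b)) / (h b * h b)"
    if "\<And>p q. D (p * q) = D p * q + p * D q" for D
    using Fract by (simp add: fract_deriv_Fract[of D, OF that] fract_lift_Fract hom_mult hom_minus)
  have "E (fract_lift h g) = (E (h a) * h b - h a * E (h b)) / (h b * h b)"
    using Fract by (simp add: fract_lift_Fract derivation_divide[of E, OF E])
  then show ?thesis
    unfolding D[of D1, OF D1] D[of D2, OF D2] h
    by (simp add: add_divide_distrib diff_divide_distrib algebra_simps)
qed

end

lemma rf_dx_0 [simp]: "rf_dx 0 = 0" and rf_dy_0 [simp]: "rf_dy 0 = 0"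
  using rf_dx_diff[of 0 0] rf_dy_diff[of 0 0] by simp_all

lemma rf_const_hom: "comm_ring_hom rf_const"
  by unfold_locales (simp_all add: rf_const_def flip: to_fract_add to_fract_mult one_pCons)

section \<open>Substitution of a pair (X, Y) for (x, y)\<close>

definition rf_eval :: "'a::field_char_0 ratfun2 \<Rightarrow> 'a ratfun2 \<Rightarrow> 'a poly poly \<Rightarrow> 'a ratfun2" where
  "rf_eval X Y p = poly (map_poly (\<lambda>c. poly (map_poly rf_const c) X) p) Y"

lemma poly_map_poly_hom:
  assumes "comm_ring_hom h"
  shows "comm_ring_hom (\<lambda>p. poly (map_poly h p) x)"
proof -
  interpret comm_ring_hom h by fact
  interpret m: map_poly_comm_ring_hom h ..
  show ?thesis
    by unfold_locales (simp_all add: m.hom_add m.hom_mult)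
qed

lemma rf_eval_hom: "comm_ring_hom (rf_eval X Y)"
  unfolding rf_eval_def by (intro poly_map_poly_hom rf_const_hom)

lemma rf_eval_0 [simp]: "rf_eval X Y 0 = 0"
  by (simp add: rf_eval_def)

lemma rf_eval_pCons: "rf_eval X Y (pCons c p) = rf_eval X Y [:c:] + Y * rf_eval X Y p"
  and rf_eval_pCons_const:
    "rf_eval X Y [:pCons k c:] = rf_const k + X * rf_eval X Y [:c:]"
proof -
  interpret k: comm_ring_hom rf_const by (rule rf_const_hom)
  interpret i: comm_ring_hom "\<lambda>c. poly (map_poly rf_const c) X"
    by (rule poly_map_poly_hom[OF rf_const_hom])
  show "rf_eval X Y (pCons c p) = rf_eval X Y [:c:] + Y * rf_eval X Y p"
    by (simp add: rf_eval_def Polynomial.map_poly_pCons)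
  show "rf_eval X Y [:pCons k c:] = rf_const k + X * rf_eval X Y [:c:]"
    by (simp add: rf_eval_def Polynomial.map_poly_pCons)
qed

text \<open>The chain rule for a k-derivation \<open>E\<close>, by induction on the coefficients in
  k[x] and then on the polynomial in y.\<close>

lemma rf_eval_deriv:
  assumes add: "\<And>u v. E (u + v) = E u + E v"
    and mult: "\<And>u v. E (u * v) = E u * v + u * E v"
    and const: "\<And>c. E (rf_const c) = 0"
  shows "E (rf_eval X Y p) = rf_eval X Y (poly_dx p) * E X + rf_eval X Y (pderiv p) * E Y"
proof -
  interpret ev: comm_ring_hom "rf_eval X Y" by (rule rf_eval_hom)
  have E0: "E 0 = 0"
    using add[of 0 0] by (metis add_cancel_right_left add_0)
  have inner: "E (rf_eval X Y [:c:]) = rf_eval X Y [:pderiv c:] * E X" for c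
  proof (induction c)
    case (pCons k c)
    have "[:pderiv (pCons k c):] = [:c:] + [:pCons 0 (pderiv c):]"
      by (simp add: pderiv_pCons)
    then have d: "rf_eval X Y [:pderiv (pCons k c):] =
        rf_eval X Y [:c:] + X * rf_eval X Y [:pderiv c:]"
      by (simp only: ev.hom_add rf_eval_pCons_const) (simp add: rf_const_def)
    show ?case
      unfolding d using pCons by (simp add: rf_eval_pCons_const add mult const algebra_simps)
  qed (simp add: E0)
  show ?thesis
  proof (induction p)
    case (pCons c p)
    have "rf_eval X Y (pderiv (pCons c p)) = rf_eval X Y p + Y * rf_eval X Y (pderiv p)"
      by (simp add: pderiv_pCons ev.hom_add rf_eval_pCons[of X Y 0])
    then show ?case
      using pCons by (simp add: rf_eval_pCons[of X Y c p] rf_eval_pCons[of X Y "pderiv c" "poly_dx p"]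
          poly_dx_pCons add mult inner algebra_simps)
  qed (simp add: E0)
qed

text \<open>The Jacobian criterion for algebraic independence. If p(X,Y) = 0, differentiating in x
  and in y gives a linear system for the values of both partial derivatives of p, with determinant
  J(X,Y). Hence these vanish too, and induction on degrees brings p down to a constant;
  characteristic zero is what makes the descent end there.\<close>

lemma rf_eval_eq_0_imp_eq_0:
  assumes J: "rf_dx X * rf_dy Y - rf_dy X * rf_dx Y \<noteq> 0"
  shows "rf_eval X Y p = 0 \<Longrightarrow> p = 0"
proof (induction "degree p" arbitrary: p rule: less_induct)
  case less
  have derivs: "rf_eval X Y (poly_dx p) = 0 \<and> rf_eval X Y (pderiv p) = 0"
    if "rf_eval X Y p = 0" for p
  proof -
    let ?a = "rf_eval X Y (poly_dx p)" and ?b = "rf_eval X Y (pderiv p)"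
    have x: "?a * rf_dx X + ?b * rf_dx Y = 0"
      using rf_eval_deriv[of rf_dx X Y p] that
      by (simp add: rf_dx_add rf_dx_mult)
    have y: "?a * rf_dy X + ?b * rf_dy Y = 0"
      using rf_eval_deriv[of rf_dy X Y p] that
      by (simp add: rf_dy_add rf_dy_mult)
    \<comment> \<open>Cramer's rule for the system given by \<open>x\<close> and
      \<open>y\<close>.\<close>
    have "?a * (rf_dx X * rf_dy Y - rf_dy X * rf_dx Y) = 
        (?a * rf_dx X + ?b * rf_dx Y) * rf_dy Y - (?a * rf_dy X + ?b * rf_dy Y) * rf_dx Y"
      by (simp add: algebra_simps)
    moreover have "?b * (rf_dx X * rf_dy Y - rf_dy X * rf_dx Y) = 
        (?a * rf_dy X + ?b * rf_dy Y) * rf_dx X - (?a * rf_dx X + ?b * rf_dx Y) * rf_dy X"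
      by (simp add: algebra_simps)
    ultimately show ?thesis
      using J unfolding x y by simp
  qed
  have inner: "c = 0" if "rf_eval X Y [:c:] = 0" for c
    using that
  proof (induction "degree c" arbitrary: c rule: less_induct)
    case (less c)
    have "degree c = 0"
    proof (rule ccontr)
      assume c: "degree c \<noteq> 0"
      have "rf_eval X Y [:pderiv c:] = 0"
        using derivs[OF less.prems] by (simp add: poly_dx_pCons)
      with less.hyps[of "pderiv c"] c have "pderiv c = 0"
        by (simp add: degree_pderiv)
      with c show False
        by (simp add: pderiv_eq_0_iff)
    qed
    then obtain k where "c = [:k:]"
      by (auto elim: degree_eq_zeroE)
    with less.prems show "c = 0"
      by (simp add: rf_eval_pCons_const) (simp add: rf_const_def)
  qed
  have "degree p = 0"
  proof (rule ccontr)
    assume p: "degree p \<noteq> 0"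
    have "rf_eval X Y (pderiv p) = 0"
      using derivs[OF less.prems] by simp
    with less.hyps[of "pderiv p"] p have "pderiv p = 0"
      by (simp add: degree_pderiv)
    with p show False
      by (simp add: pderiv_eq_0_iff)
  qed
  then obtain c where "p = [:c:]"
    by (auto elim: degree_eq_zeroE)
  with inner less.prems show "p = 0"
    by simp
qed

text \<open>A nonzero bracket means a nonzero Jacobian, so substitution is injective and extends to
  fractions. The chain rule makes the Jacobian of two images the image of their Jacobian times
  J(X,Y), and J(X,Y) f' is the image of f.\<close>

lemma poisson_embedsI:
  assumes f: "f = to_fract p" "p \<noteq> 0"
    and XY: "pbracket f' X Y = rf_eval X Y p"
    and nz: "pbracket f' X Y \<noteq> 0"
  shows "poisson_embeds (pbracket f) (pbracket f')"
proof -
  have J: "rf_dx X * rf_dy Y - rf_dy X * rf_dx Y \<noteq> 0"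
    using nz by (auto simp: pbracket_def)
  interpret ev: comm_ring_hom "rf_eval X Y" by (rule rf_eval_hom)
  interpret fract_embedding "rf_eval X Y"
    by unfold_locales (rule rf_eval_eq_0_imp_eq_0[OF J])
  define \<phi> where "\<phi> = fract_lift (rf_eval X Y)"
  have const: "\<phi> (rf_const c) = rf_const c" for c
    by (simp add: \<phi>_def rf_const_def[of c] fract_lift_to_fract rf_eval_pCons_const)
  have dx: "rf_dx (\<phi> g) = \<phi> (rf_dx g) * rf_dx X + \<phi> (rf_dy g) * rf_dx Y" for g
    using fract_lift_deriv[where ?D1.0 = poly_dx and ?D2.0 = pderiv and E = rf_dx, OF _ _ _ rf_eval_deriv]
    by (simp add: \<phi>_def poly_dx_mult pderiv_mult rf_dx_add rf_dx_mult
        flip: rf_dx_def rf_dy_def)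
  have dy: "rf_dy (\<phi> g) = \<phi> (rf_dx g) * rf_dy X + \<phi> (rf_dy g) * rf_dy Y" for g
    using fract_lift_deriv[where ?D1.0 = poly_dx and ?D2.0 = pderiv and E = rf_dy, OF _ _ _ rf_eval_deriv]
    by (simp add: \<phi>_def poly_dx_mult pderiv_mult rf_dy_add rf_dy_mult
        flip: rf_dx_def rf_dy_def)
  have add: "\<phi> (g + h) = \<phi> g + \<phi> h" and mult: "\<phi> (g * h) = \<phi> g * \<phi> h" for g h
    by (simp_all add: \<phi>_def fract_lift_add fract_lift_mult)
  have diff: "\<phi> (g - h) = \<phi> g - \<phi> h" for g h
    using add[of "g - h" h] by simp
  have \<phi>_f: "\<phi> f = (rf_dx X * rf_dy Y - rf_dy X * rf_dx Y) * f'"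
    using XY by (simp add: f \<phi>_def fract_lift_to_fract pbracket_def)
  have "\<phi> (pbracket f g h) = pbracket f' (\<phi> g) (\<phi> h)" for g h
    unfolding pbracket_def dx dy mult diff \<phi>_f by (simp add: algebra_simps)
  then show ?thesis
    unfolding poisson_embeds_def poisson_hom_def using const add mult by blast
qed

section \<open>Embeddings given by monomials\<close>

lemma rf_const_0 [simp]: "rf_const 0 = 0" and rf_const_1 [simp]: "rf_const 1 = 1"
  by (simp_all add: rf_const_def flip: one_pCons)

lemma rf_const_of_nat: "rf_const (of_nat n) = of_nat n"
proof -
  interpret comm_ring_hom rf_const by (rule rf_const_hom)
  show ?thesis by (rule hom_of_nat)
qed

lemma rf_const_eq_0_iff [simp]: "rf_const c = 0 \<longleftrightarrow> c = 0"
  by (simp add: rf_const_def)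

lemma rf_x_nonzero [simp]: "rf_x \<noteq> 0" and rf_y_nonzero [simp]: "rf_y \<noteq> 0"
  by (simp_all add: rf_x_def rf_y_def)

lemma rf_of_nat_eq_0_iff [simp]: "(of_nat n :: 'a::field_char_0 ratfun2) = 0 \<longleftrightarrow> n = 0"
  unfolding rf_const_of_nat[symmetric] by simp

text \<open>All three families of Poisson fields have the form K{c x^k y^l}, so this one criterion
  yields every embedding.\<close>

lemma poisson_embeds_monomialI:
  assumes c: "c \<noteq> 0" and XY: "pbracket f' X Y = rf_const c * X ^ k * Y ^ l"
    and nz: "X \<noteq> 0" "Y \<noteq> 0"
  shows "poisson_embeds (pbracket (rf_const c * rf_x ^ k * rf_y ^ l)) (pbracket f')"
proof (rule poisson_embedsI)
  interpret ev: comm_ring_hom "rf_eval X Y" by (rule rf_eval_hom)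
  let ?p = "[:[:c:]:] * [:[:0, 1:]:] ^ k * [:0, 1:] ^ l"
  show "rf_const c * rf_x ^ k * rf_y ^ l = to_fract ?p"
    unfolding to_fract_hom.hom_mult to_fract_hom.hom_power by (simp add: rf_const_def rf_x_def rf_y_def)
  show "?p \<noteq> 0"
    using c by simp
  have "rf_eval X Y [:[:c:]:] = rf_const c" "rf_eval X Y [:[:0, 1:]:] = X"
      "rf_eval X Y [:0, 1:] = Y"
    using rf_eval_pCons[of X Y 0 1] by (simp_all add: rf_eval_pCons_const)
  then show "pbracket f' X Y = rf_eval X Y ?p"
    unfolding ev.hom_mult ev.hom_power XY by simp
  show "pbracket f' X Y \<noteq> 0"
    unfolding XY using c nz by simp
qed

lemma derivation_power:
  fixes E :: "'c::comm_semiring_1 \<Rightarrow> 'c"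
  assumes mult: "\<And>u v. E (u * v) = E u * v + u * E v"
  shows "E (u ^ Suc n) = of_nat (Suc n) * u ^ n * E u"
proof (induction n)
  case (Suc n)
  have "E (u ^ Suc (Suc n)) = E u * u ^ Suc n + u * E (u ^ Suc n)"
    by (simp only: power_Suc[of u "Suc n"] mult)
  then show ?case
    unfolding Suc by (simp add: algebra_simps)
qed simp

lemmas rf_dx_power = derivation_power[of rf_dx, OF rf_dx_mult]
  and rf_dy_power = derivation_power[of rf_dy, OF rf_dy_mult]
  and rf_dx_divide = derivation_divide[of rf_dx, OF rf_dx_mult]
  and rf_dy_divide = derivation_divide[of rf_dy, OF rf_dy_mult]

lemma rf_dx_of_nat [simp]: "rf_dx (of_nat n) = 0" and rf_dy_of_nat [simp]: "rf_dy (of_nat n) = 0"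
  unfolding rf_const_of_nat[symmetric] by simp_all

lemma rf_dx_1 [simp]: "rf_dx 1 = 0" and rf_dy_1 [simp]: "rf_dy 1 = 0"
  using rf_dx_of_nat[of 1] rf_dy_of_nat[of 1] by simp_all

lemma rf_dx_minus: "rf_dx (- g) = - rf_dx g"
  using rf_dx_diff[of 0 g] by simp

lemma K_Weyl_embeds_K_1n0:
  assumes "n > 0"
  shows "poisson_embeds (K_Weyl :: 'a::field_char_0 ratfun2 \<Rightarrow> _) (K_1n0 n)"
proof -
  obtain k where n: "n = Suc k"
    using assms gr0_implies_Suc by blast
  \<comment> \<open>The pair is X = -1/(n x^n y), Y = y: the x-derivative of X is 1/(x^(n+1) y), the
    inverse of the structure function.\<close>
  let ?v = "of_nat n * rf_x ^ n * rf_y :: 'a ratfun2"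
  have "poisson_embeds (pbracket (rf_const 1 * rf_x ^ 0 * rf_y ^ 0))
      (pbracket (rf_x ^ (n + 1) * rf_y :: 'a ratfun2))"
  proof (rule poisson_embeds_monomialI)
    have v: "?v \<noteq> 0"
      using assms by simp
    have "rf_dx ?v = of_nat n * (of_nat n * rf_x ^ k) * rf_y"
      unfolding n by (simp add: rf_dx_mult rf_dx_power del: power_Suc of_nat_Suc)
    then have "rf_dx (- 1 / ?v) = 1 / (rf_x ^ (n + 1) * rf_y)"
      using v by (simp add: rf_dx_divide[OF v] rf_dx_minus)
        (simp add: n field_simps del: of_nat_Suc)
    then show "pbracket (rf_x ^ (n + 1) * rf_y) (- 1 / ?v) rf_y
        = rf_const 1 * (- 1 / ?v) ^ 0 * rf_y ^ 0"
      by (simp add: pbracket_def)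
  qed (use assms in simp_all)
  then show ?thesis
    by (simp add: K_Weyl_def K_1n0_def)
qed

text \<open>For z > 0 the pair is x^z, y; for z < 0 it is x^(-z), 1/y, the inverse supplying the
  sign.\<close>

lemma K_q_embeds_K_q:
  fixes q :: "'a::field_char_0"
  assumes "of_int z * q \<noteq> 0"
  shows "poisson_embeds (K_q (of_int z * q)) (K_q q)"
proof -
  interpret c: comm_ring_hom "rf_const :: 'a \<Rightarrow> _" by (rule rf_const_hom)
  have "z \<noteq> 0"
    using assms by auto
  then obtain k where z: "z = int (Suc k) \<or> z = - int (Suc k)"
    by (cases z rule: int_cases2) (metis not0_implies_Suc of_nat_0 minus_zero)+
  have z_const: "rf_const (of_int z * q) = of_int z * rf_const q"
    by (simp add: c.hom_mult c.hom_of_int)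
  have x: "rf_dx (rf_x ^ Suc k :: 'a ratfun2) = of_nat (Suc k) * rf_x ^ k"
    "rf_dy (rf_x ^ Suc k :: 'a ratfun2) = 0"
    by (simp_all add: rf_dx_power rf_dy_power del: power_Suc of_nat_Suc)
  have "poisson_embeds (pbracket (rf_const (of_int z * q) * rf_x ^ 1 * rf_y ^ 1))
      (pbracket (rf_const q * rf_x * rf_y))"
    using z
  proof
    assume z: "z = int (Suc k)"
    show ?thesis
    proof (rule poisson_embeds_monomialI[OF assms])
      show "pbracket (rf_const q * rf_x * rf_y) (rf_x ^ Suc k) rf_y
          = rf_const (of_int z * q) * (rf_x ^ Suc k) ^ 1 * rf_y ^ 1"
        unfolding pbracket_def x z_const by (simp add: z)
    qed simp_all
  next
    assume z: "z = - int (Suc k)"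
    show ?thesis
    proof (rule poisson_embeds_monomialI[OF assms])
      show "pbracket (rf_const q * rf_x * rf_y) (rf_x ^ Suc k) (1 / rf_y)
          = rf_const (of_int z * q) * (rf_x ^ Suc k) ^ 1 * (1 / rf_y) ^ 1"
        unfolding pbracket_def x z_const by (simp add: z rf_dy_divide field_simps)
    qed simp_all
  qed
  then show ?thesis
    by (simp add: K_q_def)
qed

lemma K_1n0_embeds_K_1n0:
  assumes "m dvd n" "m > 0" "n > 0"
  shows "poisson_embeds (K_1n0 m :: 'a::field_char_0 ratfun2 \<Rightarrow> _) (K_1n0 n)"
proof -
  obtain k where k: "n = m * k" "k > 0"
    using assms by (metis dvdE mult_0_right neq0_conv)
  obtain k' where k': "k = Suc k'"
    using k gr0_implies_Suc by blast
  \<comment> \<open>The pair will be X = k x^k, Y = y^(k^(m-1)). Its bracket has coefficient k * k *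
    k^(m-1) = k^(m+1) and x-exponent (k-1) + (mk+1) = k(m+1), matching X^(m+1) Y.\<close>
  obtain j where j: "k ^ (m - 1) = Suc j"
    using k by (metis not0_implies_Suc power_eq_0_iff neq0_conv)
  have "k * k ^ (m - 1) = k ^ m"
    using assms by (simp add: power_eq_if)
  then have kj: "k * Suc j = k ^ m"
    by (simp only: j)
  let ?X = "of_nat k * rf_x ^ k :: 'a ratfun2" and ?Y = "rf_y ^ Suc j :: 'a ratfun2"
  have "poisson_embeds (pbracket (rf_const 1 * rf_x ^ (m + 1) * rf_y ^ 1))
      (pbracket (rf_x ^ (n + 1) * rf_y :: 'a ratfun2))"
  proof (rule poisson_embeds_monomialI)
    have X: "rf_dx ?X = of_nat k * (of_nat k * rf_x ^ k')" "rf_dy ?X = 0"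
      unfolding k' by (simp_all add: rf_dx_mult rf_dy_mult rf_dx_power rf_dy_power
          del: power_Suc of_nat_Suc)
    have Y: "rf_dy ?Y = of_nat (Suc j) * rf_y ^ j"
      by (simp add: rf_dy_power del: power_Suc of_nat_Suc)
    have "pbracket (rf_x ^ (n + 1) * rf_y) ?X ?Y =
        of_nat k * of_nat (k * Suc j) * (rf_x ^ k' * rf_x ^ (n + 1)) * (rf_y ^ j * rf_y)"
      unfolding pbracket_def X Y by (simp add: algebra_simps)
    also have "\<dots> = of_nat (k ^ (m + 1)) * rf_x ^ (k * (m + 1)) * ?Y"
      unfolding kj power_add[symmetric] by (simp add: k k' algebra_simps)
    finally show "pbracket (rf_x ^ (n + 1) * rf_y) ?X ?Y = rf_const 1 * ?X ^ (m + 1) * ?Y ^ 1"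
      by (simp add: power_mult_distrib power_add power_mult)
  qed (use k in simp_all)
  then show ?thesis
    by (simp add: K_1n0_def)
qed

section \<open>Localization at a prime of k[x][y]\<close>

text \<open>For a prime \<open>\<pi>\<close> this is the local ring at \<open>\<pi>\<close>, the
  fractions without a pole along \<open>\<pi>\<close>. Some representation must avoid
  \<open>\<pi>\<close> in its denominator, so no reduced form is needed.\<close>

definition localization :: "'b::idom \<Rightarrow> 'b fract set" where
  "localization \<pi> = {Fract a b | a b. \<not> \<pi> dvd b}"

text \<open>Logarithmic derivatives turn products into sums. With v = \<open>\<pi>\<close> and u a
  unit of the local ring, the only possible pole is isolated in the first term and is
  simple.\<close>

lemma log_deriv_power_int:
  fixes E :: "'c::field \<Rightarrow> 'c"
  assumes mult: "\<And>u v. E (u * v) = E u * v + u * E v" and u: "u \<noteq> 0" and v: "v \<noteq> 0"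
  shows "E (v powi a * u) / (v powi a * u) = of_int a * E v / v + E u / u"
proof -
  have one: "E 1 = 0"
    using mult[of 1 1] by (metis add_cancel_right_left mult_1_left mult_1_right)
  have pow: "E (v ^ n) / v ^ n = of_nat n * E v / v" for n
  proof (cases n)
    case (Suc k)
    then show ?thesis
      using v derivation_power[of E v k, OF mult] by (simp add: field_simps)
  qed (simp add: one)
  have "E (v powi a) / v powi a = of_int a * E v / v"
  proof (cases a rule: int_cases2)
    case (nonneg n)
    then show ?thesis by (simp add: pow)
  next
    case (nonpos n)
    have "E (1 / v ^ n) / (1 / v ^ n) = - (E (v ^ n) / v ^ n)"
      using v derivation_divide[of E "v ^ n" 1, OF mult] by (simp add: one field_simps)
    with nonpos show ?thesis
      by (simp add: pow power_int_minus inverse_eq_divide)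
  qed
  moreover have "v powi a \<noteq> 0" using v by simp
  ultimately show ?thesis
    using u v by (simp add: mult add_divide_distrib)
qed

locale prime_localization =
  fixes \<pi> :: "'a::field_char_0 poly poly"
  assumes prime: "prime_elem \<pi>"
begin

lemma localizationI: "\<not> \<pi> dvd b \<Longrightarrow> Fract a b \<in> localization \<pi>"
  by (auto simp: localization_def)

lemma localizationE:
  assumes "g \<in> localization \<pi>"
  obtains a b where "g = Fract a b" "b \<noteq> 0" "\<not> \<pi> dvd b"
  using assms by (auto simp: localization_def)

lemma pi_nonzero: "to_fract \<pi> \<noteq> 0"
  using prime by auto

lemma to_fract_in: "to_fract a \<in> localization \<pi>"
  unfolding to_fract_def using prime by (intro localizationI) (auto simp: prime_elem_def)

lemma rf_const_in: "rf_const c \<in> localization \<pi>"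
  by (simp add: rf_const_def to_fract_in)

lemma mult_in: "g \<in> localization \<pi> \<Longrightarrow> h \<in> localization \<pi> \<Longrightarrow> g * h \<in> localization \<pi>"
  by (elim localizationE) (auto intro!: localizationI simp: prime_elem_dvd_mult_iff[OF prime])

lemma add_in: "g \<in> localization \<pi> \<Longrightarrow> h \<in> localization \<pi> \<Longrightarrow> g + h \<in> localization \<pi>"
  by (elim localizationE) (auto intro!: localizationI simp: prime_elem_dvd_mult_iff[OF prime])

lemma diff_in: "g \<in> localization \<pi> \<Longrightarrow> h \<in> localization \<pi> \<Longrightarrow> g - h \<in> localization \<pi>"
  by (elim localizationE) (auto intro!: localizationI simp: prime_elem_dvd_mult_iff[OF prime])

lemma power_in: "g \<in> localization \<pi> \<Longrightarrow> g ^ n \<in> localization \<pi>"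
  by (induction n) (use to_fract_in[of 1] in \<open>auto intro: mult_in\<close>)

lemma of_int_in: "of_int z \<in> localization \<pi>"
proof -
  interpret comm_ring_hom rf_const by (rule rf_const_hom)
  show ?thesis using rf_const_in[of "of_int z"] by (simp add: hom_of_int)
qed

lemma pi_inverse_notin: "1 / to_fract \<pi> \<notin> localization \<pi>"
proof
  assume "1 / to_fract \<pi> \<in> localization \<pi>"
  then obtain a b where ab: "1 / to_fract \<pi> = Fract a b" "b \<noteq> 0" "\<not> \<pi> dvd b"
    by (elim localizationE)
  then have "b = \<pi> * a"
    using prime by (auto simp: to_fract_def eq_fract One_fract_def)
  with ab show False
    by simp
qed

text \<open>The degree in y plus the degree in x of the leading coefficient is additive under
  multiplication and vanishes only on constants among nonzero polynomials, so splitting off factors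
  \<open>\<pi>\<close> terminates.\<close>

lemma prime_decompose_poly:
  "p \<noteq> 0 \<Longrightarrow> \<exists>k r. p = \<pi> ^ k * r \<and> \<not> \<pi> dvd r"
proof (induction "degree p + degree (lead_coeff p)" arbitrary: p rule: less_induct)
  case less
  show ?case
  proof (cases "\<pi> dvd p")
    case False
    then show ?thesis by (intro exI[of _ 0] exI[of _ p]) simp
  next
    case True
    then obtain r where r: "p = \<pi> * r" ..
    with less.prems have nz: "\<pi> \<noteq> 0" "r \<noteq> 0" by auto
    have "degree \<pi> + degree (lead_coeff \<pi>) \<noteq> 0"
    proof
      assume "degree \<pi> + degree (lead_coeff \<pi>) = 0"
      then obtain c where "\<pi> = [:[:c:]:]"
        by (auto elim!: degree_eq_zeroE)
      with nz have "\<pi> * [:[:1 / c:]:] = 1"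
        by simp
      then show False
        using prime by (metis dvd_triv_left prime_elem_not_unit)
    qed
    moreover have "degree p = degree \<pi> + degree r"
      "degree (lead_coeff p) = degree (lead_coeff \<pi>) + degree (lead_coeff r)"
      unfolding r lead_coeff_mult using nz by (simp_all add: degree_mult_eq)
    ultimately have "degree r + degree (lead_coeff r) < degree p + degree (lead_coeff p)"
      by simp
    with less.hyps nz obtain k s where "r = \<pi> ^ k * s" "\<not> \<pi> dvd s" by blast
    then show ?thesis
      by (intro exI[of _ "Suc k"] exI[of _ s]) (simp add: r)
  qed
qed

text \<open>The exponent \<open>a\<close> is the order of g along \<open>\<pi>\<close>, and u is a
  unit of the local ring.\<close>

lemma prime_decompose:
  assumes "g \<noteq> 0"
  obtains a u where "g = to_fract \<pi> powi a * u" "u \<noteq> 0"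
    "u \<in> localization \<pi>" "1 / u \<in> localization \<pi>"
proof (cases g)
  case (Fract p q)
  with assms have "p \<noteq> 0" by (auto simp: fract_collapse)
  then obtain k r where r: "p = \<pi> ^ k * r" "\<not> \<pi> dvd r"
    using prime_decompose_poly by blast
  obtain l s where s: "q = \<pi> ^ l * s" "\<not> \<pi> dvd s"
    using prime_decompose_poly Fract by blast
  have nz: "r \<noteq> 0" "s \<noteq> 0" using r s by auto
  have "g = to_fract \<pi> powi (int k - int l) * Fract r s"
    using pi_nonzero unfolding Fract(1) r s
    by (simp add: Fract_conv_to_fract power_int_diff to_fract_hom.hom_mult to_fract_hom.hom_power)
  moreover have "Fract r s \<noteq> 0" "1 / Fract r s = Fract s r"
    using nz by (simp_all add: Fract_conv_to_fract)
  ultimately show ?thesis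
    using that localizationI r s by metis
qed

lemma rf_deriv_in:
  assumes "u \<in> localization \<pi>"
  shows "rf_dx u \<in> localization \<pi>" "rf_dy u \<in> localization \<pi>"
  using assms
  by (auto elim!: localizationE intro!: localizationI
      simp: rf_dx_Fract rf_dy_Fract prime_elem_dvd_mult_iff[OF prime])

text \<open>J(X,Y)/(XY) is the determinant of the logarithmic derivatives of X and Y. Each entry has
  at most a simple pole, and the polar parts of the two rows are both multiples of the gradient of
  \<open>\<pi>\<close>, so the determinant has no double pole.\<close>

lemma jacobian_in:
  assumes "X \<noteq> 0" "Y \<noteq> 0"
  shows "to_fract \<pi> * ((rf_dx X * rf_dy Y - rf_dy X * rf_dx Y) / (X * Y)) \<in> localization \<pi>"
proof -
  obtain a u where X: "X = to_fract \<pi> powi a * u" and u: "u \<noteq> 0"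
    "u \<in> localization \<pi>" "1 / u \<in> localization \<pi>"
    using assms prime_decompose by metis
  obtain b w where Y: "Y = to_fract \<pi> powi b * w" and w: "w \<noteq> 0"
    "w \<in> localization \<pi>" "1 / w \<in> localization \<pi>"
    using assms prime_decompose by metis
  let ?p = "to_fract \<pi>"
  define u1 u2 w1 w2 where "u1 = rf_dx u * (1 / u)" and "u2 = rf_dy u * (1 / u)"
    and "w1 = rf_dx w * (1 / w)" and "w2 = rf_dy w * (1 / w)"
  define p1 p2 where "p1 = rf_dx ?p" and "p2 = rf_dy ?p"
  have in_loc: "u1 \<in> localization \<pi>" "u2 \<in> localization \<pi>" "w1 \<in> localization \<pi>"
      "w2 \<in> localization \<pi>" "p1 \<in> localization \<pi>" "p2 \<in> localization \<pi>"
    unfolding u1_def u2_def w1_def w2_def p1_def p2_def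
    using u w by (simp_all only: mult_in rf_deriv_in to_fract_in)
  have X_log: "rf_dx X / X = of_int a * p1 / ?p + u1" "rf_dy X / X = of_int a * p2 / ?p + u2"
    unfolding X p1_def p2_def
    by (simp_all add: log_deriv_power_int[of rf_dx, OF rf_dx_mult u(1) pi_nonzero]
        log_deriv_power_int[of rf_dy, OF rf_dy_mult u(1) pi_nonzero] u1_def u2_def)
  have Y_log: "rf_dx Y / Y = of_int b * p1 / ?p + w1" "rf_dy Y / Y = of_int b * p2 / ?p + w2"
    unfolding Y p1_def p2_def
    by (simp_all add: log_deriv_power_int[of rf_dx, OF rf_dx_mult w(1) pi_nonzero]
        log_deriv_power_int[of rf_dy, OF rf_dy_mult w(1) pi_nonzero] w1_def w2_def)
  \<comment> \<open>The terms with a double pole cancel.\<close>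
  have p_inv: "?p * inverse ?p = 1"
    using pi_nonzero by simp
  have "?p * ((rf_dx X * rf_dy Y - rf_dy X * rf_dx Y) / (X * Y)) =
      ?p * (rf_dx X / X * (rf_dy Y / Y) - rf_dy X / X * (rf_dx Y / Y))"
    by (simp add: diff_divide_distrib)
  also have "\<dots> = ?p * inverse ?p * (of_int a * p1 * w2 + of_int b * p2 * u1)
      + ?p * u1 * w2 - (?p * inverse ?p * (of_int a * p2 * w1 + of_int b * p1 * u2) + ?p * u2 * w1)"
    unfolding X_log Y_log by (simp add: divide_inverse algebra_simps)
  also have "\<dots> = of_int a * p1 * w2 + of_int b * p2 * u1 + ?p * u1 * w2
      - (of_int a * p2 * w1 + of_int b * p1 * u2 + ?p * u2 * w1)"
    unfolding p_inv by simp
  also have "\<dots> \<in> localization \<pi>"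
    by (intro diff_in add_in mult_in of_int_in to_fract_in in_loc)
  finally show ?thesis .
qed

text \<open>The equation reads X^m = f J(X,Y)/(XY), so \<open>\<pi>\<close> X^m has no pole. A pole
  of X of order k \<ge> 1 would give it one of order km - 1 \<ge> 1.\<close>

lemma pole_free:
  assumes nz: "X \<noteq> 0" "Y \<noteq> 0" and m: "m \<ge> 2"
    and eq: "pbracket (to_fract f) X Y = X ^ (m + 1) * Y"
  shows "X \<in> localization \<pi>"
proof -
  let ?p = "to_fract \<pi>"
  have "X ^ m = (rf_dx X * rf_dy Y - rf_dy X * rf_dx Y) / (X * Y) * to_fract f"
    using eq nz by (simp add: pbracket_def field_simps)
  then have "?p * X ^ m = ?p * ((rf_dx X * rf_dy Y - rf_dy X * rf_dx Y) / (X * Y)) * to_fract f"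
    by simp
  then have pXm: "?p * X ^ m \<in> localization \<pi>"
    using mult_in[OF jacobian_in[OF nz] to_fract_in] by simp
  obtain a u where X: "X = ?p powi a * u" and u: "u \<noteq> 0"
    "u \<in> localization \<pi>" "1 / u \<in> localization \<pi>"
    using nz prime_decompose by metis
  show ?thesis
  proof (cases a rule: int_cases2)
    case (nonneg k)
    then show ?thesis
      unfolding X by (simp add: mult_in power_in to_fract_in u)
  next
    case (nonpos k)
    show ?thesis
    proof (cases "k = 0")
      case True
      with nonpos u show ?thesis unfolding X by simp
    next
      case False
      \<comment> \<open>Since km \<ge> 2, the unit part and the surplus factor
        \<open>\<pi>\<close>^j can be multiplied away, leaving exactly
        1/\<open>\<pi>\<close>.\<close>
      then obtain j where j: "k * m = Suc (Suc j)"
        using m by (cases k; cases m) (auto simp: Suc_le_eq gr0_conv_Suc)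
      have "X ^ m * ?p ^ (k * m) = u ^ m"
        using pi_nonzero unfolding X nonpos
        by (simp add: power_int_minus power_mult_distrib power_mult field_simps)
      then have "?p * X ^ m * (1 / u) ^ m * ?p ^ j = 1 / ?p"
        using pi_nonzero u unfolding j by (simp add: field_simps)
      moreover have "?p * X ^ m * (1 / u) ^ m * ?p ^ j \<in> localization \<pi>"
        by (intro mult_in pXm power_in to_fract_in u)
      ultimately show ?thesis
        using pi_inverse_notin by simp
    qed
  qed
qed

end

text \<open>By unique factorization in k[x,y], a denominator is a product of primes, and each can be
  cancelled in turn because g has no pole along it.\<close>

lemma polynomial_if_in_localizations:
  fixes g :: "'a::field_char_0 ratfun2"
  assumes "\<And>\<pi>. prime_elem \<pi> \<Longrightarrow> g \<in> localization \<pi>"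
  obtains p where "g = to_fract p"
proof -
  have "\<exists>p. g = to_fract p"
    if "g * to_fract (prod_mset F) = to_fract r" "\<And>\<pi>. \<pi> \<in># F \<Longrightarrow> prime_elem \<pi>" for F r
    using that
  proof (induction F arbitrary: r)
    case (add \<pi> F)
    interpret prime_localization \<pi>
      by unfold_locales (rule add.prems(2), simp)
    obtain a b where ab: "g = Fract a b" "b \<noteq> 0" "\<not> \<pi> dvd b"
      using assms[OF prime] by (elim localizationE)
    \<comment> \<open>Comparing the two representations of g gives \<open>\<pi>\<close> dvd b r with
      b prime to \<open>\<pi>\<close>, so \<open>\<pi>\<close> divides the numerator
      \<open>r\<close>.\<close>
    then have "to_fract a = g * to_fract b"
      by (simp add: Fract_conv_to_fract)
    then have "to_fract (a * (\<pi> * prod_mset F)) = to_fract (b * r)"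
      using add.prems(1)[symmetric] by (simp add: Fract_conv_to_fract mult_ac)
    then have "\<pi> * (a * prod_mset F) = b * r"
      unfolding to_fract_eq_iff by (simp add: mult_ac)
    then have "\<pi> dvd r"
      using ab(3) prime by (metis dvd_triv_left prime_elem_dvd_mult_iff)
    then obtain s where s: "r = \<pi> * s" ..
    have "g * to_fract (prod_mset F) = to_fract s"
      using add.prems(1) pi_nonzero by (simp add: s)
    with add show ?case by simp
  qed auto
  note clear = this
  obtain a b where ab: "g = Fract a b" "b \<noteq> 0"
    by (cases g)
  show ?thesis
  proof (cases "b dvd 1")
    case True
    then obtain c where "b * c = 1" by (metis dvdE)
    then have "g = to_fract (a * c)"
      using ab by (simp add: to_fract_def eq_fract mult_ac)
    then show ?thesis by (rule that)
  next
    case False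
    with ab obtain F where F: "mset_factors F b"
      using mset_factors_exist by blast
    have "g * to_fract b = to_fract a"
      using ab by (simp add: Fract_conv_to_fract)
    moreover have "b = prod_mset F" "\<And>\<pi>. \<pi> \<in># F \<Longrightarrow> prime_elem \<pi>"
      using F by (auto elim!: mset_factorsE)
    ultimately show ?thesis using clear that by metis
  qed
qed

text \<open>The equation would make J(X,Y)/(XY) equal to q/(x^(n+1) y), whose pole along x has order
  at least 2, against \<open>jacobian_in\<close>.\<close>

lemma K_1n0_no_log_canonical_pair:
  fixes X Y :: "'a::field_char_0 ratfun2"
  assumes nz: "X \<noteq> 0" "Y \<noteq> 0" "q \<noteq> 0" and n: "n \<ge> 1"
  shows "pbracket (rf_x ^ (n + 1) * rf_y) X Y \<noteq> rf_const q * X * Y"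
proof
  assume eq: "pbracket (rf_x ^ (n + 1) * rf_y) X Y = rf_const q * X * Y"
  let ?\<pi> = "[:[:0, 1:]:] :: 'a poly poly"
  interpret prime_localization ?\<pi>
    by unfold_locales (intro lift_prime_elem_poly prime_elem_linear_field_poly, simp)
  obtain k where k: "n = Suc k"
    using n by (cases n) auto
  define J where "J = (rf_dx X * rf_dy Y - rf_dy X * rf_dx Y) / (X * Y)"
  have J: "J * (rf_x ^ (n + 1) * rf_y) = rf_const q"
    using eq nz by (simp add: J_def pbracket_def field_simps)
  \<comment> \<open>With k = n - 1, multiplying by x^k y / q reduces the pole to exactly
    1/x.\<close>
  have "to_fract ?\<pi> * J * (rf_x ^ k * rf_y) * rf_const (1 / q) * rf_x
      = J * (rf_x ^ (n + 1) * rf_y) * rf_const (1 / q)"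
    unfolding rf_x_def[symmetric] by (simp add: k mult_ac)
  also have "\<dots> = 1"
    unfolding J using nz by (simp add: rf_const_def flip: to_fract_mult one_pCons)
  finally have "to_fract ?\<pi> * J * (rf_x ^ k * rf_y) * rf_const (1 / q) = 1 / to_fract ?\<pi>"
    unfolding rf_x_def[symmetric] by (simp add: field_simps)
  moreover have "to_fract ?\<pi> * J * (rf_x ^ k * rf_y) * rf_const (1 / q) \<in> localization ?\<pi>"
    unfolding J_def rf_x_def rf_y_def
    by (intro mult_in jacobian_in nz power_in to_fract_in rf_const_in)
  ultimately show False
    using pi_inverse_notin by simp
qed

section \<open>Leading coefficients of the Jacobian\<close>

text \<open>The bound need not be sharp, so the coefficient may vanish; in return the relation is
  compatible with differences.\<close>

definition has_top :: "nat \<Rightarrow> 'c::idom poly \<Rightarrow> 'c \<Rightarrow> bool" where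
  "has_top n p c \<longleftrightarrow> degree p \<le> n \<and> coeff p n = c"

lemma has_top_lead: "has_top (degree p) p (lead_coeff p)"
  by (simp add: has_top_def)

lemma has_top_const: "has_top 0 [:c:] c"
  by (simp add: has_top_def)

lemma has_top_diff: "has_top n p c \<Longrightarrow> has_top n q d \<Longrightarrow> has_top n (p - q) (c - d)"
  by (simp add: has_top_def degree_diff_le)

lemma has_top_mult:
  assumes "has_top m p c" "has_top n q d"
  shows "has_top (m + n) (p * q) (c * d)"
proof (cases "degree p = m \<and> degree q = n")
  case True
  with assms show ?thesis
    by (auto simp: has_top_def coeff_mult_degree_sum degree_mult_le)
next
  case False
  with assms have "degree p + degree q < m + n"
    by (auto simp: has_top_def)
  then have "degree (p * q) < m + n"
    using degree_mult_le[of p q] by simp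
  moreover have "c * d = 0"
    using assms False by (auto simp: has_top_def coeff_eq_0)
  ultimately show ?thesis
    by (simp add: has_top_def coeff_eq_0)
qed

text \<open>\<open>pCons 0 (pderiv p)\<close> is the Euler derivation, which multiplies each y^i by
  i. In degree 0 it gives 0, which the non-sharp bound admits.\<close>

lemma has_top_euler:
  "has_top (degree p) (pCons 0 (pderiv p)) (of_nat (degree p) * lead_coeff p)"
  using degree_pderiv_le[of p]
  by (cases "degree p") (auto simp: has_top_def coeff_pderiv elim!: degree_eq_zeroE)

lemma has_top_poly_dx: "has_top (degree p) (poly_dx p) (pderiv (lead_coeff p))"
  by (simp add: has_top_def coeff_poly_dx) (simp add: poly_dx_def degree_map_poly_le)

text \<open>The numerator of y times the Jacobian of a/b and c/d. The Euler derivation y d/dy replaces d/dy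
  because it does not lower degrees.\<close>

definition log_jacobian ::
  "'a::field_char_0 poly poly \<Rightarrow> 'a poly poly \<Rightarrow> 'a poly poly \<Rightarrow> 'a poly poly \<Rightarrow> 'a poly poly" where
  "log_jacobian a b c d =
    (poly_dx a * b - a * poly_dx b) * (pCons 0 (pderiv c) * d - c * pCons 0 (pderiv d)) -
    (pCons 0 (pderiv a) * b - a * pCons 0 (pderiv b)) * (poly_dx c * d - c * poly_dx d)"

lemma log_jacobian_Fract:
  assumes "b \<noteq> 0" "d \<noteq> 0"
  shows "pbracket f (Fract a b) (Fract c d) * rf_y * to_fract (b * b * d * d) =
    f * to_fract (log_jacobian a b c d)"
proof -
  have y: "to_fract (pCons 0 p) = rf_y * to_fract p" for p :: "'a poly poly"
    by (simp add: rf_y_def flip: to_fract_mult)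
  define a1 b1 c1 d1 where "a1 = to_fract (poly_dx a)" and "b1 = to_fract (poly_dx b)"
    and "c1 = to_fract (poly_dx c)" and "d1 = to_fract (poly_dx d)"
  define a2 b2 c2 d2 where "a2 = to_fract (pderiv a)" and "b2 = to_fract (pderiv b)"
    and "c2 = to_fract (pderiv c)" and "d2 = to_fract (pderiv d)"
  have nz: "to_fract b \<noteq> 0" "to_fract d \<noteq> 0"
    using assms by simp_all
  define A B C D where "A = to_fract a" and "B = to_fract b" and "C = to_fract c" and "D = to_fract d"
  have dx: "rf_dx (Fract a b) * (B * B) = a1 * B - A * b1"
    "rf_dx (Fract c d) * (D * D) = c1 * D - C * d1"
    "rf_dy (Fract a b) * (B * B) = a2 * B - A * b2"
    "rf_dy (Fract c d) * (D * D) = c2 * D - C * d2"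
    unfolding rf_dx_Fract[OF assms(1)] rf_dx_Fract[OF assms(2)] rf_dy_Fract[OF assms(1)]
      rf_dy_Fract[OF assms(2)] using nz
    by (simp_all add: Fract_conv_to_fract A_def B_def C_def D_def a1_def b1_def c1_def d1_def
        a2_def b2_def c2_def d2_def)
  have "pbracket f (Fract a b) (Fract c d) * rf_y * to_fract (b * b * d * d) =
      f * rf_y * (rf_dx (Fract a b) * (B * B) * (rf_dy (Fract c d) * (D * D)) -
      rf_dy (Fract a b) * (B * B) * (rf_dx (Fract c d) * (D * D)))"
    by (simp add: pbracket_def B_def D_def algebra_simps)
  also have "\<dots> = f * to_fract (log_jacobian a b c d)"
    unfolding dx
    by (simp add: log_jacobian_def y A_def B_def C_def D_def a1_def b1_def c1_def d1_def
        a2_def b2_def c2_def d2_def algebra_simps)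
  finally show ?thesis .
qed

text \<open>With s = deg a - deg b and r = deg c - deg d, the value is ABCD times r (A/B)'/(A/B) - s
  (C/D)'/(C/D): the contribution of the leading terms (A/B) y^s and (C/D) y^r.\<close>

lemma has_top_log_jacobian:
  fixes a b c d :: "'a::field_char_0 poly poly"
  defines "A \<equiv> lead_coeff a" and "B \<equiv> lead_coeff b" and "C \<equiv> lead_coeff c" and "D \<equiv> lead_coeff d"
  shows "has_top (degree a + degree b + (degree c + degree d)) (log_jacobian a b c d)
    ((pderiv A * B - A * pderiv B) * ((of_nat (degree c) - of_nat (degree d)) * (C * D)) -
     (of_nat (degree a) - of_nat (degree b)) * (A * B) * (pderiv C * D - C * pderiv D))"
proof -
  have "has_top (degree a + degree b + (degree c + degree d)) (log_jacobian a b c d)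
     ((pderiv A * B - A * pderiv B) * (of_nat (degree c) * C * D - C * (of_nat (degree d) * D)) -
     (of_nat (degree a) * A * B - A * (of_nat (degree b) * B)) * (pderiv C * D - C * pderiv D))"
    unfolding log_jacobian_def A_def B_def C_def D_def
    by (intro has_top_diff has_top_mult has_top_lead has_top_poly_dx has_top_euler)
  then show ?thesis
    by (simp add: algebra_simps)
qed

lemma degree_log_jacobian:
  "degree (log_jacobian a b c d) \<le> degree a + degree b + (degree c + degree d)"
  using has_top_log_jacobian[of a b c d] by (simp add: has_top_def)

section \<open>Exclusions by degrees in y and in x\<close>

lemma to_fract_monomial:
  "rf_const k * rf_x ^ n * rf_y ^ l = to_fract ([:[:k:] * [:0, 1:] ^ n:] * [:0, 1:] ^ l)"
proof -
  have "[:p ^ n:] = [:p:] ^ n" for p :: "'a poly"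
  proof (induction n)
    case (Suc n)
    show ?case unfolding power_Suc Suc[symmetric] by simp
  qed simp
  moreover have "[:p * q:] = [:p:] * [:q:]" for p q :: "'a poly"
    by simp
  ultimately show ?thesis
    unfolding rf_const_def rf_x_def rf_y_def
    by (simp only: to_fract_hom.hom_mult to_fract_hom.hom_power)
qed

text \<open>The equation says y J(X,Y)/(XY) = q y, but the left side has y-degree at most 0.\<close>

lemma Weyl_no_log_canonical_pair:
  fixes X Y :: "'a::field_char_0 ratfun2"
  assumes nz: "X \<noteq> 0" "Y \<noteq> 0" "q \<noteq> 0"
  shows "pbracket 1 X Y \<noteq> rf_const q * X * Y"
proof
  assume eq: "pbracket 1 X Y = rf_const q * X * Y"
  obtain a b where X: "X = Fract a b" "b \<noteq> 0" by (cases X)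
  obtain c d where Y: "Y = Fract c d" "d \<noteq> 0" by (cases Y)
  have ac: "a \<noteq> 0" "c \<noteq> 0" using nz X Y by (auto simp: fract_collapse)
  have "to_fract (log_jacobian a b c d) = rf_const q * X * Y * rf_y * to_fract (b * b * d * d)"
    using log_jacobian_Fract[OF X(2) Y(2), of 1 a c] eq X Y by simp
  also have "\<dots> = to_fract ([:0, [:q:]:] * (a * b * c * d))"
  proof -
    have "to_fract [:0, [:q:]:] = rf_const q * rf_y"
      by (simp add: rf_const_def rf_y_def flip: to_fract_mult)
    then have "to_fract ([:0, [:q:]:] * (a * b * c * d)) = rf_const q * rf_y * to_fract (a * b * c * d)"
      by (simp only: to_fract_mult)
    then show ?thesis
      by (simp only:) (use X Y in \<open>simp add: Fract_conv_to_fract\<close>)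
  qed
  finally have "log_jacobian a b c d = [:0, [:q:]:] * (a * b * c * d)"
    unfolding to_fract_eq_iff .
  then have "degree (log_jacobian a b c d) = 1 + (degree a + degree b + degree c + degree d)"
    using nz ac X Y by (simp add: degree_mult_eq del: mult_pCons_left)
  then show False
    using degree_log_jacobian[of a b c d] by simp
qed

text \<open>Without poles X is a polynomial, so y X^m has positive y-degree; it would equal y
  J(X,Y)/(XY), of y-degree at most 0.\<close>

lemma Weyl_no_power_pair:
  fixes X Y :: "'a::field_char_0 ratfun2"
  assumes nz: "X \<noteq> 0" "Y \<noteq> 0" and m: "m \<ge> 2"
  shows "pbracket 1 X Y \<noteq> X ^ (m + 1) * Y"
proof
  assume eq: "pbracket 1 X Y = X ^ (m + 1) * Y"
  have loc: "X \<in> localization \<pi>" if "prime_elem \<pi>" for \<pi>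
    using prime_localization.pole_free[of \<pi> X Y m 1] that nz m eq
    by (simp add: prime_localization_def)
  obtain P where "X = to_fract P"
    using loc by (rule polynomial_if_in_localizations)
  then have X: "X = Fract P 1"
    by (simp add: to_fract_def)
  obtain c d where Y: "Y = Fract c d" "d \<noteq> 0" by (cases Y)
  have ac: "P \<noteq> 0" "c \<noteq> 0" using nz X Y by (auto simp: fract_collapse)
  have "to_fract (log_jacobian P 1 c d) = X ^ (m + 1) * Y * rf_y * to_fract (d * d)"
    using log_jacobian_Fract[OF one_neq_zero Y(2), of 1 P c] eq X Y by simp
  also have "\<dots> = to_fract ([:0, 1:] * (P ^ (m + 1) * c * d))"
    using Y by (simp add: Fract_conv_to_fract X rf_y_def to_fract_hom.hom_power
        del: mult_pCons_left)
  finally have "log_jacobian P 1 c d = [:0, 1:] * (P ^ (m + 1) * c * d)"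
    unfolding to_fract_eq_iff .
  then have "degree (log_jacobian P 1 c d) = 1 + ((m + 1) * degree P + degree c + degree d)"
    using ac Y by (simp add: degree_mult_eq degree_power_eq del: mult_pCons_left)
  then show False
    using degree_log_jacobian[of P 1 c d] by simp
qed

text \<open>The constant \<open>k\<close> and the case n = 0 are included so that targets K{x^(n+1)
  y} and K{qxy} are treated together. The number \<open>e\<close> is the x-degree of X, which turns
  out to lie in k[x].\<close>

lemma power_pair_degree:
  fixes X Y :: "'a::field_char_0 ratfun2"
  assumes nz: "X \<noteq> 0" "Y \<noteq> 0" and m: "m \<ge> 2"
    and eq: "pbracket (rf_const k * rf_x ^ (n + 1) * rf_y) X Y = X ^ (m + 1) * Y"
  shows "\<exists>e\<ge>1. n = m * e"
proof -
  let ?f = "[:[:k:] * [:0, 1:] ^ (n + 1):] :: 'a poly poly"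
  have f: "rf_const k * rf_x ^ (n + 1) * rf_y = to_fract ?f * rf_y"
    using to_fract_monomial[of k "n + 1" 0] by simp
  have f': "rf_const k * rf_x ^ (n + 1) * rf_y = to_fract (?f * [:0, 1:])"
    unfolding f by (simp only: rf_y_def to_fract_mult)
  have loc: "X \<in> localization \<pi>" if "prime_elem \<pi>" for \<pi>
    using prime_localization.pole_free[of \<pi> X Y m "?f * [:0, 1:]"] that nz m eq
    unfolding f' by (simp add: prime_localization_def)
  obtain P where "X = to_fract P"
    using loc by (rule polynomial_if_in_localizations)
  then have X: "X = Fract P 1"
    by (simp add: to_fract_def)
  obtain c d where Y: "Y = Fract c d" "d \<noteq> 0" by (cases Y)
  have ac: "P \<noteq> 0" "c \<noteq> 0" using nz X Y by (auto simp: fract_collapse)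
  define g where "g = to_fract ?f"
  have "rf_y * to_fract (?f * log_jacobian P 1 c d) = rf_y * (X ^ (m + 1) * Y * to_fract (d * d))"
    using log_jacobian_Fract[OF one_neq_zero Y(2), of "g * rf_y" P c] eq[unfolded f]
    unfolding to_fract_mult[of ?f] g_def[symmetric] X Y(1) by (simp add: mult_ac)
  then have "to_fract (?f * log_jacobian P 1 c d) = X ^ (m + 1) * Y * to_fract (d * d)"
    by simp
  also have "\<dots> = to_fract (P ^ (m + 1) * c * d)"
    using Y by (simp add: Fract_conv_to_fract X to_fract_hom.hom_power)
  finally have jac: "?f * log_jacobian P 1 c d = P ^ (m + 1) * c * d"
    unfolding to_fract_eq_iff .
  \<comment> \<open>Degrees in y: \<open>?f\<close> is constant in y, so the right side of
    \<open>jac\<close> cannot exceed the bound for the Jacobian.\<close>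
  have "(m + 1) * degree P + degree c + degree d = degree (?f * log_jacobian P 1 c d)"
    unfolding jac using ac Y by (simp add: degree_mult_eq degree_power_eq)
  also have "\<dots> \<le> degree P + degree c + degree d"
    using degree_mult_le[of ?f "log_jacobian P 1 c d"] degree_log_jacobian[of P 1 c d] by simp
  finally have "degree P = 0"
    using m by simp
  then obtain A where P: "P = [:A:]"
    by (auto elim: degree_eq_zeroE)
  let ?z = "of_int (int (degree c) - int (degree d)) :: 'a poly"
  have A: "A \<noteq> 0" using ac P by simp
  have PA: "P ^ j = [:A ^ j:]" for j
    unfolding P by (induction j) simp_all
  \<comment> \<open>Now X = A lies in k[x], so of the two terms of the leading coefficient only the
    one with \<open>pderiv A\<close> survives.\<close>
  have "has_top (0 + (0 + 0 + (degree c + degree d))) (?f * log_jacobian P 1 c d)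
    ([:k:] * [:0, 1:] ^ (n + 1) * (pderiv A * (?z * (lead_coeff c * lead_coeff d))))"
    using has_top_mult[OF has_top_const[of "[:k:] * [:0, 1:] ^ (n + 1)"]
        has_top_log_jacobian[of P 1 c d]]
    by (simp add: P del: mult_pCons_left)
  moreover have "has_top (0 + degree c + degree d) (P ^ (m + 1) * c * d)
      (A ^ (m + 1) * lead_coeff c * lead_coeff d)"
    unfolding PA by (intro has_top_mult has_top_const has_top_lead)
  ultimately have "[:k:] * [:0, 1:] ^ (n + 1) * (pderiv A * (?z * (lead_coeff c * lead_coeff d))) =
      A ^ (m + 1) * lead_coeff c * lead_coeff d"
    unfolding jac has_top_def by (simp del: mult_pCons_left)
  then have "[:k:] * [:0, 1:] ^ (n + 1) * pderiv A * ?z * (lead_coeff c * lead_coeff d) =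
      A ^ (m + 1) * (lead_coeff c * lead_coeff d)"
    by (simp only: mult_ac)
  then have top: "[:k:] * [:0, 1:] ^ (n + 1) * pderiv A * ?z = A ^ (m + 1)"
    using ac Y by (simp del: mult_pCons_left)
  then have fac: "[:k:] \<noteq> 0" "pderiv A \<noteq> 0" "?z \<noteq> 0"
    using A by (auto simp del: mult_pCons_left)
  have "degree ([:k:] * [:0, 1:] ^ (n + 1) * pderiv A * ?z) = n + 1 + degree (pderiv A)"
    using fac by (simp add: degree_mult_eq degree_power_eq del: mult_pCons_left of_int_diff)
  \<comment> \<open>Degrees in x of k z x^(n+1) A' = A^(m+1), where A' \<noteq> 0 makes A
    nonconstant; this gives n = m deg A.\<close>
  then have "n + 1 + (degree A - 1) = (m + 1) * degree A"
    unfolding top degree_power_eq[OF A] by (simp add: degree_pderiv mult_ac)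
  moreover have "degree A \<ge> 1"
    using fac by (auto simp: pderiv_eq_0_iff Suc_le_eq)
  ultimately show ?thesis
    by (intro exI[of _ "degree A"]) (auto simp: algebra_simps)
qed

text \<open>Passing to leading coefficients in y and then in x replaces X and Y by monomials, for
  which the ratio p/q is the determinant of the exponent vectors.\<close>

lemma log_pair_ratio:
  fixes X Y :: "'a::field_char_0 ratfun2"
  assumes nz: "X \<noteq> 0" "Y \<noteq> 0"
    and eq: "pbracket (rf_const q * rf_x * rf_y) X Y = rf_const p * X * Y"
  shows "\<exists>z::int. p = of_int z * q"
proof -
  obtain a b where X: "X = Fract a b" "b \<noteq> 0" by (cases X)
  obtain c d where Y: "Y = Fract c d" "d \<noteq> 0" by (cases Y)
  have ac: "a \<noteq> 0" "c \<noteq> 0" using nz X Y by (auto simp: fract_collapse)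
  have "rf_y * (rf_const q * rf_x * to_fract (log_jacobian a b c d)) =
      rf_y * (rf_const p * X * Y * to_fract (b * b * d * d))"
    using log_jacobian_Fract[OF X(2) Y(2), of "rf_const q * rf_x * rf_y" a c] eq X Y
    by (simp add: mult_ac)
  then have "rf_const q * rf_x * to_fract (log_jacobian a b c d) =
      rf_const p * X * Y * to_fract (b * b * d * d)"
    by simp
  also have "rf_const q * rf_x = to_fract [:[:0, q:]:]"
    by (simp add: rf_const_def rf_x_def flip: to_fract_mult)
  also have "rf_const p * X * Y * to_fract (b * b * d * d) = to_fract ([:[:p:]:] * (a * b * (c * d)))"
    using X Y by (simp add: Fract_conv_to_fract rf_const_def del: mult_pCons_left)
  finally have jac: "[:[:0, q:]:] * log_jacobian a b c d = [:[:p:]:] * (a * b * (c * d))"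
    by (simp del: mult_pCons_left flip: to_fract_mult)
  define A B C D where "A = lead_coeff a" and "B = lead_coeff b"
    and "C = lead_coeff c" and "D = lead_coeff d"
  define z w :: int where "z = int (degree c) - int (degree d)" and "w = int (degree a) - int (degree b)"
  have "has_top (0 + (degree a + degree b + (degree c + degree d))) ([:[:0, q:]:] * log_jacobian a b c d)
    ([:0, q:] * ((pderiv A * B - A * pderiv B) * (of_int z * (C * D)) -
      of_int w * (A * B) * (pderiv C * D - C * pderiv D)))"
    using has_top_mult[OF has_top_const has_top_log_jacobian] unfolding A_def B_def C_def D_def
    by (simp add: z_def w_def del: mult_pCons_left)
  moreover have "has_top (0 + (degree a + degree b + (degree c + degree d)))
      ([:[:p:]:] * (a * b * (c * d))) ([:p:] * (A * B * (C * D)))"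
    unfolding A_def B_def C_def D_def by (intro has_top_mult has_top_const has_top_lead)
  ultimately have eq_top: "[:0, q:] * ((pderiv A * B - A * pderiv B) * (of_int z * (C * D)) -
      of_int w * (A * B) * (pderiv C * D - C * pderiv D)) = [:p:] * (A * B * (C * D))"
    unfolding jac has_top_def by (simp del: mult_pCons_left)
  \<comment> \<open>The factor x of q x is moved onto the derivatives, so that d/dx becomes the
    Euler derivation x d/dx and \<open>has_top_euler\<close> applies a second time.\<close>
  have shift: "pCons 0 s = [:0, 1:] * s" for s :: "'a poly"
    by simp
  have "[:q:] * ((x * u * B - A * (x * v)) * (r * (C * D)) - A * B * (t * (x * s * D - C * (x * s')))) =
      [:q:] * x * ((u * B - A * v) * (r * (C * D)) - t * (A * B) * (s * D - C * s'))"
    for x u v r t s s' :: "'a poly"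
    by (simp add: algebra_simps del: mult_pCons_left mult_pCons_right)
  moreover have "[:q:] * [:0, 1:] = [:0, q:]"
    by simp
  ultimately have top: "[:q:] * ((pCons 0 (pderiv A) * B - A * pCons 0 (pderiv B)) * ([:of_int z:] * (C * D)) -
      A * B * ([:of_int w:] * (pCons 0 (pderiv C) * D - C * pCons 0 (pderiv D))))
      = [:p:] * (A * B * (C * D))"
    unfolding shift[of "pderiv _"] using eq_top by (simp only: of_int_poly)
  have "has_top (0 + (degree A + degree B + (0 + (degree C + degree D))))
    ([:q:] * ((pCons 0 (pderiv A) * B - A * pCons 0 (pderiv B)) * ([:of_int z:] * (C * D)) -
      A * B * ([:of_int w:] * (pCons 0 (pderiv C) * D - C * pCons 0 (pderiv D)))))
    (q * ((of_nat (degree A) * lead_coeff A * lead_coeff B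
       - lead_coeff A * (of_nat (degree B) * lead_coeff B)) *
      (of_int z * (lead_coeff C * lead_coeff D)) -
      lead_coeff A * lead_coeff B * (of_int w * (of_nat (degree C) * lead_coeff C * lead_coeff D
       - lead_coeff C * (of_nat (degree D) * lead_coeff D)))))"
    by (intro has_top_mult has_top_diff has_top_const has_top_lead has_top_euler)
  moreover have "has_top (0 + (degree A + degree B + (degree C + degree D)))
      ([:p:] * (A * B * (C * D))) (p * (lead_coeff A * lead_coeff B * (lead_coeff C * lead_coeff D)))"
    by (intro has_top_mult has_top_const has_top_lead)
  ultimately have "q * ((of_nat (degree A) * lead_coeff A * lead_coeff B
       - lead_coeff A * (of_nat (degree B) * lead_coeff B)) *
      (of_int z * (lead_coeff C * lead_coeff D)) -
      lead_coeff A * lead_coeff B * (of_int w * (of_nat (degree C) * lead_coeff C * lead_coeff D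
       - lead_coeff C * (of_nat (degree D) * lead_coeff D))))
      = p * (lead_coeff A * lead_coeff B * (lead_coeff C * lead_coeff D))"
    unfolding top has_top_def by (simp del: mult_pCons_left)
  moreover define L where "L = lead_coeff A * lead_coeff B * (lead_coeff C * lead_coeff D)"
  \<comment> \<open>The leading exponents in x and y are (deg A - deg B, w) for X and (deg C - deg
    D, z) for Y; the integer is their determinant.\<close>
  ultimately have "of_int ((int (degree A) - int (degree B)) * z - w * (int (degree C) - int (degree D)))
      * q * L = p * L"
    by (simp add: algebra_simps)
  moreover have "L \<noteq> 0"
    using ac X Y by (simp add: L_def A_def B_def C_def D_def)
  ultimately have "p = of_int ((int (degree A) - int (degree B)) * z - w * (int (degree C) - int (degree D))) * q"
    by (metis mult_right_cancel)
  then show ?thesis ..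
qed

section \<open>The residue in y\<close>

text \<open>With D = d/dx on k(x) this is the x-derivative on k(x)((y)). The condition D 0 = 0 keeps
  the support bounded below.\<close>

definition fls_map_deriv :: "('c::field \<Rightarrow> 'c) \<Rightarrow> 'c fls \<Rightarrow> 'c fls" where
  "fls_map_deriv D f = Abs_fls (\<lambda>n. D (fls_nth f n))"

lemma fls_map_deriv_nth:
  assumes "D 0 = 0"
  shows "fls_nth (fls_map_deriv D f) n = D (fls_nth f n)"
  unfolding fls_map_deriv_def
  by (rule nth_Abs_fls_lower_bound[of "fls_subdegree f"]) (simp add: assms)

text \<open>Differentiating coefficients can raise the subdegree. Arbitrary lower bounds let all
  products in the Leibniz rule be summed over one range.\<close>

lemma fls_times_nth_bounds:
  fixes f g :: "'c::field fls"
  assumes M: "\<And>i. i < M \<Longrightarrow> fls_nth f i = 0" and N: "\<And>i. i < N \<Longrightarrow> fls_nth g i = 0"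
  shows "fls_nth (f * g) n = (\<Sum>i=M..n - N. fls_nth f i * fls_nth g (n - i))"
proof (cases "f = 0 \<or> g = 0")
  case False
  have "M \<le> fls_subdegree f" "N \<le> fls_subdegree g"
    using False M N by (meson nth_fls_subdegree_nonzero not_less)+
  then show ?thesis
    unfolding fls_times_nth(2) by (intro sum.mono_neutral_left) auto
qed auto

lemma fls_map_deriv_mult:
  assumes add: "\<And>u v. D (u + v) = D u + D v" and mult: "\<And>u v. D (u * v) = D u * v + u * D v"
  shows "fls_map_deriv D (f * g) = fls_map_deriv D f * g + f * fls_map_deriv D g"
proof (rule fls_eqI)
  fix n
  have D0: "D 0 = 0"
    using add[of 0 0] by (metis add_cancel_right_left add_0)
  have D_sum: "D (sum h A) = (\<Sum>i\<in>A. D (h i))" for h :: "int \<Rightarrow> 'a" and A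
    by (induction A rule: infinite_finite_induct) (simp_all add: D0 add)
  let ?S = "\<lambda>h. \<Sum>i=fls_subdegree f..n - fls_subdegree g. h i"
  have "fls_nth (f * g) n = ?S (\<lambda>i. fls_nth f i * fls_nth g (n - i))"
    "fls_nth (fls_map_deriv D f * g) n = ?S (\<lambda>i. fls_nth (fls_map_deriv D f) i * fls_nth g (n - i))"
    "fls_nth (f * fls_map_deriv D g) n = ?S (\<lambda>i. fls_nth f i * fls_nth (fls_map_deriv D g) (n - i))"
    by (rule fls_times_nth_bounds; simp add: fls_map_deriv_nth D0)+
  then show "fls_nth (fls_map_deriv D (f * g)) n = fls_nth (fls_map_deriv D f * g + f * fls_map_deriv D g) n"
    by (simp add: fls_map_deriv_nth D0 D_sum mult sum.distrib)
qed

text \<open>The embedding of k[x][y] in the field k(x)((y)); its lift to fractions is the Laurent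
  expansion at y = 0.\<close>

definition y_expansion :: "'a::field_char_0 poly poly \<Rightarrow> 'a poly fract fls" where
  "y_expansion p = fps_to_fls (fps_of_poly (fract_poly p))"

lemma y_expansion_nth: "fls_nth (y_expansion p) n = (if n < 0 then 0 else to_fract (coeff p (nat n)))"
  by (simp add: y_expansion_def coeff_map_poly)

lemma y_expansion_hom: "fract_embedding y_expansion"
proof -
  interpret t: map_poly_comm_ring_hom "to_fract :: 'a poly \<Rightarrow> 'a poly fract"
    by unfold_locales simp_all
  have "fract_poly p = 0 \<Longrightarrow> p = 0" for p :: "'a poly poly"
    by (rule poly_eqI) (metis coeff_0 coeff_map_poly to_fract_0 to_fract_eq_0_iff)
  then show ?thesis
    by unfold_locales
      (auto simp: y_expansion_def t.hom_mult fps_of_poly_add fps_of_poly_mult fls_times_fps_to_fls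
        fps_of_poly_eq_iff[of _ 0, simplified])
qed

abbreviation x_deriv :: "'a::field_char_0 poly fract \<Rightarrow> 'a poly fract" where
  "x_deriv \<equiv> fract_deriv pderiv"

lemma x_deriv_Fract: "b \<noteq> 0 \<Longrightarrow> x_deriv (Fract a b) = Fract (pderiv a * b - a * pderiv b) (b * b)"
  by (rule fract_deriv_Fract) (simp_all add: pderiv_mult)

lemma x_deriv_add: "x_deriv (g + h) = x_deriv g + x_deriv h"
  by (cases g, cases h) (simp add: x_deriv_Fract eq_fract pderiv_add pderiv_mult algebra_simps)

lemma x_deriv_mult: "x_deriv (g * h) = x_deriv g * h + g * x_deriv h"
  by (cases g, cases h) (simp add: x_deriv_Fract eq_fract pderiv_mult algebra_simps)

lemma x_deriv_to_fract: "x_deriv (to_fract a) = to_fract (pderiv a)"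
  by (simp add: to_fract_def x_deriv_Fract)

lemma x_deriv_0: "x_deriv 0 = 0"
  using x_deriv_to_fract[of 0] by simp

definition y_residue :: "'a::field_char_0 ratfun2 \<Rightarrow> 'a poly fract" where
  "y_residue g = fls_nth (fract_lift y_expansion g) (-1)"

lemma y_residue_diff: "y_residue (g - h) = y_residue g - y_residue h"
proof -
  interpret fract_embedding y_expansion by (rule y_expansion_hom)
  have "fract_lift y_expansion (g - h) = fract_lift y_expansion g - fract_lift y_expansion h"
    using fract_lift_add[of "g - h" h] by simp
  then show ?thesis by (simp add: y_residue_def)
qed

lemma y_residue_rf_dy: "y_residue (rf_dy g) = 0"
proof -
  interpret fract_embedding y_expansion by (rule y_expansion_hom)
  \<comment> \<open>The shape with factors 1 and 0 fits the two-derivation form of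
    \<open>fract_lift_deriv\<close>.\<close>
  have h: "fls_deriv (y_expansion p) = y_expansion (pderiv p) * 1 + y_expansion (pderiv p) * 0" for p
    by (simp add: y_expansion_def fls_deriv_fps_to_fls flip: fps_of_poly_pderiv)
      (rule poly_eqI, simp add: coeff_pderiv coeff_map_poly to_fract_hom.hom_of_nat)
  have "fls_deriv (fract_lift y_expansion g) = fract_lift y_expansion (rf_dy g) * 1 +
      fract_lift y_expansion (rf_dy g) * 0"
    unfolding rf_dy_def
    by (rule fract_lift_deriv) (simp_all only: h pderiv_mult fls_deriv_mult mult_ac add_ac)
  then have "fract_lift y_expansion (rf_dy g) = fls_deriv (fract_lift y_expansion g)"
    by simp
  then show ?thesis by (simp add: y_residue_def fls_deriv_residue del: fls_deriv_nth)
qed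

text \<open>The x-derivative acts on each coefficient of the expansion separately, in particular on
  that of 1/y.\<close>

lemma y_residue_rf_dx: "y_residue (rf_dx g) = x_deriv (y_residue g)"
proof -
  interpret fract_embedding y_expansion by (rule y_expansion_hom)
  have h: "fls_map_deriv x_deriv (y_expansion p) =
      y_expansion (poly_dx p) * 1 + y_expansion (poly_dx p) * 0" for p
    by (intro fls_eqI) (simp add: fls_map_deriv_nth x_deriv_0 x_deriv_to_fract y_expansion_nth coeff_poly_dx)
  have "fls_map_deriv x_deriv (fract_lift y_expansion g) = fract_lift y_expansion (rf_dx g) * 1 +
      fract_lift y_expansion (rf_dx g) * 0"
    unfolding rf_dx_def
    by (rule fract_lift_deriv)
      (simp_all only: h poly_dx_mult fls_map_deriv_mult[of x_deriv, OF x_deriv_add x_deriv_mult])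
  then have "fract_lift y_expansion (rf_dx g) = fls_map_deriv x_deriv (fract_lift y_expansion g)"
    by simp
  then show ?thesis by (simp add: y_residue_def fls_map_deriv_nth x_deriv_0)
qed

lemma y_residue_simple_pole: "y_residue (to_fract [:a:] / (to_fract [:b:] * rf_y)) = Fract a b"
  if "b \<noteq> 0"
proof -
  interpret fract_embedding y_expansion by (rule y_expansion_hom)
  have "fract_lift y_expansion (Fract [:a:] [:0, b:]) = y_expansion [:a:] / y_expansion [:0, b:]"
    using that by (intro fract_lift_Fract) simp
  also have "\<dots> = fls_const (Fract a b) * fls_X_inv"
  proof -
    have "fls_const (Fract a b) * fls_X_inv * y_expansion [:0, b:] = y_expansion [:a:]"
    proof -
      have "y_expansion [:0, b:] = fls_const (to_fract b) * fls_X"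
        by (rule fls_eqI) (auto simp: y_expansion_nth coeff_pCons nat_eq_iff split: nat.split)
      moreover have "y_expansion [:a:] = fls_const (to_fract a)"
        by (rule fls_eqI) (auto simp: y_expansion_nth coeff_pCons split: nat.split)
      moreover have "fls_const (Fract a b) * fls_X_inv * (fls_const (to_fract b) * fls_X) =
          fls_const (Fract a b * to_fract b) * (fls_X_inv * fls_X)"
        by (simp add: mult_ac)
      moreover have "Fract a b * to_fract b = to_fract a"
        using that by (simp add: Fract_conv_to_fract)
      ultimately show ?thesis
        by (simp add: fls_inverse_X[symmetric])
    qed
    moreover have "y_expansion [:0, b:] \<noteq> 0"
      using that hom_0_iff by auto
    ultimately show ?thesis by (simp add: field_simps)
  qed
  finally have "fls_nth (fract_lift y_expansion (Fract [:a:] [:0, b:])) (-1) = Fract a b"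
    by simp
  moreover have "to_fract [:a:] / (to_fract [:b:] * rf_y) = Fract [:a:] [:0, b:]"
    by (simp add: rf_y_def Fract_conv_to_fract flip: to_fract_mult)
  ultimately show ?thesis by (simp add: y_residue_def)
qed

text \<open>There is no logarithm in k(x). For g = a/b the equation becomes x (a'b - ab') = c b^2,
  and leading coefficients exclude it once the degrees of a and b differ, which subtracting a
  constant from g achieves.\<close>

lemma x_deriv_neq_simple_pole:
  fixes g :: "'a::field_char_0 poly fract"
  assumes c: "c \<noteq> 0"
  shows "x_deriv g \<noteq> Fract [:c:] [:0, 1:]"
proof
  assume eq: "x_deriv g = Fract [:c:] [:0, 1:]"
  obtain a b where g: "g = Fract a b" "b \<noteq> 0" by (cases g)
  have *: "pCons 0 (pderiv a * b - a * pderiv b) = smult c (b * b)"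
    using eq g by (simp add: x_deriv_Fract eq_fract mult_ac)
  \<comment> \<open>Replacing g by g - l cancels the coefficient of \<open>a\<close> in degree
    \<open>degree b\<close> and leaves the derivative unchanged.\<close>
  define l where "l = coeff a (degree b) / lead_coeff b"
  define a' where "a' = a - smult l b"
  have a': "pCons 0 (pderiv a' * b - a' * pderiv b) = smult c (b * b)"
    unfolding *[symmetric] by (simp add: a'_def pderiv_diff pderiv_smult algebra_simps)
  then have nz: "pderiv a' * b - a' * pderiv b \<noteq> 0"
    using c g by auto
  have coeff_a': "coeff a' (degree b) = 0"
    using g by (simp add: a'_def l_def)
  have "pCons 0 (pderiv a' * b - a' * pderiv b) = pCons 0 (pderiv a') * b - a' * pCons 0 (pderiv b)"
    by simp
  moreover have "has_top (degree a' + degree b) (pCons 0 (pderiv a') * b - a' * pCons 0 (pderiv b))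
      (of_nat (degree a') * lead_coeff a' * lead_coeff b
        - lead_coeff a' * (of_nat (degree b) * lead_coeff b))"
    by (intro has_top_diff has_top_mult has_top_lead has_top_euler)
  ultimately have top: "has_top (degree a' + degree b) (smult c (b * b))
      ((of_nat (degree a') - of_nat (degree b)) * (lead_coeff a' * lead_coeff b))"
    unfolding a'[symmetric] by (simp add: algebra_simps)
  have deg: "degree (smult c (b * b)) = degree b + degree b"
    using c g by (simp add: degree_mult_eq)
  have "a' \<noteq> 0"
    using nz by auto
  with coeff_a' have neq: "degree a' \<noteq> degree b"
    by (metis leading_coeff_0_iff)
  \<comment> \<open>The factor deg a' - deg b is nonzero in characteristic zero, so the left side
    has degree exactly deg a' + deg b, while the right side has degree 2 deg b.\<close>
  with \<open>a' \<noteq> 0\<close> g have "coeff (smult c (b * b)) (degree a' + degree b) \<noteq> 0"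
    using top by (simp add: has_top_def)
  then have "degree a' \<le> degree b"
    using le_degree[of "smult c (b * b)"] deg by fastforce
  moreover have "degree b \<le> degree a'"
    using top deg by (simp add: has_top_def)
  ultimately show False
    using neq by simp
qed

text \<open>A Jacobian is a y-derivative plus an x-derivative. Its residue in y is therefore a
  derivative in k(x), whereas 1/(qxy) has residue 1/(qx).\<close>

lemma K_q_no_canonical_pair:
  fixes X Y :: "'a::field_char_0 ratfun2"
  assumes q: "q \<noteq> 0"
  shows "pbracket (rf_const q * rf_x * rf_y) X Y \<noteq> 1"
proof
  assume eq: "pbracket (rf_const q * rf_x * rf_y) X Y = 1"
  have "rf_dy (rf_dx X * Y) - rf_dx (rf_dy X * Y) = rf_dx X * rf_dy Y - rf_dy X * rf_dx Y"
    by (simp add: rf_dx_mult rf_dy_mult rf_dx_dy)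
  also have "\<dots> = 1 / (rf_const q * rf_x * rf_y)"
    using eq q by (simp add: pbracket_def field_simps)
  also have "\<dots> = to_fract [:1:] / (to_fract [:[:0, q:]:] * rf_y)"
    by (simp add: rf_const_def rf_x_def flip: to_fract_mult)
  finally have "y_residue (rf_dy (rf_dx X * Y) - rf_dx (rf_dy X * Y)) = Fract 1 [:0, q:]"
    using q y_residue_simple_pole[of "[:0, q:]" 1] by simp
  then have "x_deriv (y_residue (rf_dy X * Y)) = - Fract 1 [:0, q:]"
    unfolding y_residue_diff y_residue_rf_dx y_residue_rf_dy by (metis diff_0 minus_minus)
  also have "\<dots> = Fract [:- 1 / q:] [:0, 1:]"
    using q by (simp add: eq_fract) (rule poly_eqI, simp add: coeff_pCons split: nat.split)
  finally show False
    using x_deriv_neq_simple_pole[of "- 1 / q"] q by simp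
qed

section \<open>The classification\<close>

text \<open>X and Y are the images of x and y, nonzero because a unital homomorphism of fields
  preserves invertibility.\<close>

lemma poisson_embeds_monomialE:
  assumes "poisson_embeds (pbracket (rf_const c * rf_x ^ k * rf_y ^ l)) (pbracket f)"
  obtains X Y where "X \<noteq> 0" "Y \<noteq> 0" "pbracket f X Y = rf_const c * X ^ k * Y ^ l"
proof -
  obtain \<phi> where mult: "\<And>g h. \<phi> (g * h) = \<phi> g * \<phi> h"
    and const: "\<And>c. \<phi> (rf_const c) = rf_const c"
    and br: "\<And>g h. \<phi> (pbracket (rf_const c * rf_x ^ k * rf_y ^ l) g h) = pbracket f (\<phi> g) (\<phi> h)"
    using assms unfolding poisson_embeds_def poisson_hom_def by metis
  have one: "\<phi> 1 = 1"
    using const[of 1] by simp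
  have pow: "\<phi> (g ^ n) = \<phi> g ^ n" for g n
    by (induction n) (simp_all add: one mult)
  have nz: "\<phi> g \<noteq> 0" if "g \<noteq> 0" for g
    using mult[of g "inverse g"] that one by auto
  show ?thesis
  proof
    show "\<phi> rf_x \<noteq> 0" "\<phi> rf_y \<noteq> 0"
      by (simp_all add: nz)
    show "pbracket f (\<phi> rf_x) (\<phi> rf_y) = rf_const c * \<phi> rf_x ^ k * \<phi> rf_y ^ l"
      unfolding br[symmetric] pbracket_x_y mult pow const ..
  qed
qed

lemma K_Weyl_embedsE:
  assumes "poisson_embeds K_Weyl (pbracket f)"
  obtains X Y where "X \<noteq> 0" "Y \<noteq> 0" "pbracket f X Y = 1"
  using assms poisson_embeds_monomialE[of 1 0 0 f] by (auto simp: K_Weyl_def)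

lemma K_q_embedsE:
  assumes "poisson_embeds (K_q q) (pbracket f)"
  obtains X Y where "X \<noteq> 0" "Y \<noteq> 0" "pbracket f X Y = rf_const q * X * Y"
  using assms poisson_embeds_monomialE[of q 1 1 f] by (auto simp: K_q_def)

lemma K_1n0_embedsE:
  assumes "poisson_embeds (K_1n0 m) (pbracket f)"
  obtains X Y where "X \<noteq> 0" "Y \<noteq> 0" "pbracket f X Y = X ^ (m + 1) * Y"
  using assms poisson_embeds_monomialE[of 1 "m + 1" 1 f] by (auto simp: K_1n0_def)

theorem proposition4p10:
  shows
    "(\<forall>n\<ge>2. poisson_embeds (K_Weyl :: 'a::field_char_0 ratfun2 \<Rightarrow> 'a ratfun2 \<Rightarrow> 'a ratfun2) (K_1n0 n)) \<and>
     (\<forall>p q :: 'a. p \<noteq> 0 \<longrightarrow> q \<noteq> 0 \<longrightarrow>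
        (poisson_embeds (K_q p) (K_q q) \<longleftrightarrow> (\<exists>z::int. p = of_int z * q))) \<and>
     (\<forall>m n. m \<ge> 2 \<longrightarrow> n \<ge> 2 \<longrightarrow>
        (poisson_embeds (K_1n0 m :: 'a ratfun2 \<Rightarrow> 'a ratfun2 \<Rightarrow> 'a ratfun2) (K_1n0 n) \<longleftrightarrow> m dvd n)) \<and>
     (\<forall>q :: 'a. q \<noteq> 0 \<longrightarrow>
        \<not> poisson_embeds K_Weyl (K_q q) \<and>
        (\<forall>n\<ge>2. \<not> poisson_embeds (K_1n0 n) (K_q q))) \<and>
     (\<forall>n\<ge>2. \<not> poisson_embeds (K_1n0 n :: 'a ratfun2 \<Rightarrow> 'a ratfun2 \<Rightarrow> 'a ratfun2) K_Weyl) \<and>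
     (\<forall>q :: 'a. q \<noteq> 0 \<longrightarrow>
        \<not> poisson_embeds (K_q q) K_Weyl \<and>
        (\<forall>n\<ge>2. \<not> poisson_embeds (K_q q) (K_1n0 n)))"
proof (intro conjI allI impI)
  fix n :: nat assume "n \<ge> 2"
  then show "poisson_embeds (K_Weyl :: 'a ratfun2 \<Rightarrow> _) (K_1n0 n)"
    by (intro K_Weyl_embeds_K_1n0) simp
next
  fix p q :: 'a assume pq: "p \<noteq> 0" "q \<noteq> 0"
  show "poisson_embeds (K_q p) (K_q q) \<longleftrightarrow> (\<exists>z::int. p = of_int z * q)"
  proof
    assume "poisson_embeds (K_q p) (K_q q)"
    then obtain X Y where "X \<noteq> 0" "Y \<noteq> 0"
        "pbracket (rf_const q * rf_x * rf_y) X Y = rf_const p * X * Y"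
      unfolding K_q_def[of q] by (rule K_q_embedsE)
    then show "\<exists>z::int. p = of_int z * q"
      by (rule log_pair_ratio)
  next
    assume "\<exists>z::int. p = of_int z * q"
    with pq show "poisson_embeds (K_q p) (K_q q)"
      using K_q_embeds_K_q by metis
  qed
next
  fix m n :: nat assume mn: "m \<ge> 2" "n \<ge> 2"
  show "poisson_embeds (K_1n0 m :: 'a ratfun2 \<Rightarrow> _) (K_1n0 n) \<longleftrightarrow> m dvd n"
  proof
    assume "poisson_embeds (K_1n0 m :: 'a ratfun2 \<Rightarrow> _) (K_1n0 n)"
    then obtain X Y :: "'a ratfun2" where "X \<noteq> 0" "Y \<noteq> 0"
        "pbracket (rf_x ^ (n + 1) * rf_y) X Y = X ^ (m + 1) * Y"
      unfolding K_1n0_def[of n] by (rule K_1n0_embedsE)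
    with mn power_pair_degree[of X Y m 1 n] show "m dvd n"
      by auto
  next
    assume "m dvd n"
    with mn show "poisson_embeds (K_1n0 m :: 'a ratfun2 \<Rightarrow> _) (K_1n0 n)"
      by (intro K_1n0_embeds_K_1n0) auto
  qed
next
  fix q :: 'a assume "q \<noteq> 0"
  then show "\<not> poisson_embeds K_Weyl (K_q q)"
    unfolding K_q_def using K_q_no_canonical_pair by (metis K_Weyl_embedsE)
next
  fix q :: 'a and m :: nat assume m: "m \<ge> 2"
  show "\<not> poisson_embeds (K_1n0 m) (K_q q)"
  proof
    assume "poisson_embeds (K_1n0 m) (K_q q)"
    then obtain X Y where XY: "X \<noteq> 0" "Y \<noteq> 0"
        "pbracket (rf_const q * rf_x * rf_y) X Y = X ^ (m + 1) * Y"
      unfolding K_q_def by (rule K_1n0_embedsE)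
    \<comment> \<open>K{qxy} is the case n = 0, and 0 = m e is impossible for m \<ge> 2 and e \<ge>
      1.\<close>
    with m power_pair_degree[of X Y m q 0] show False
      by auto
  qed
next
  fix m :: nat assume "m \<ge> 2"
  then show "\<not> poisson_embeds (K_1n0 m :: 'a ratfun2 \<Rightarrow> _) K_Weyl"
    unfolding K_Weyl_def using Weyl_no_power_pair by (metis K_1n0_embedsE)
next
  fix q :: 'a assume "q \<noteq> 0"
  then show "\<not> poisson_embeds (K_q q) K_Weyl"
    unfolding K_Weyl_def using Weyl_no_log_canonical_pair by (metis K_q_embedsE)
next
  fix q :: 'a and n :: nat assume "q \<noteq> 0" "n \<ge> 2"
  then have "n \<ge> 1" by simp
  with \<open>q \<noteq> 0\<close> show "\<not> poisson_embeds (K_q q) (K_1n0 n)"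
    unfolding K_1n0_def using K_1n0_no_log_canonical_pair by (metis K_q_embedsE)
qed

end
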